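(* Let $I=[p,q)$ with $p<q$ be a half-closed interval of the real line and let $\mathcal{G}_I$ be the group of interval exchange transformations of $I$. The quotient of $\mathcal{G}_I$ by its commutator group is isomorphic (as a group) to the additive group $\mathbb{R}\wedge_{\mathbb{Q}}\mathbb{R}$.
   Context: An interval exchange transformation of $I=[p,q)$ is a bijection $f:I\to I$ for which there is a finite partition of $I$ into half-closed intervals $[p_{i-1},p_i)$, $p=p_0<p_1<\dots<p_k=q$, such that the restriction of $f$ to each of them is a translation. All such maps form a group $\mathcal{G}_I$ under composition. The commutator group of $\mathcal{G}_I$ is the subgroup generated by all commutators $f^{-1}g^{-1}fg$, $f,g\in\mathcal{G}_I$. For a vector space $V$ over a field $F$, put $v\wedge w=v\otimes w-w\otimes v\in V\otimes_F V$ for $v,w\in V$; $V\wedge_F V$ denotes the subspace of $V\otimes_F V$ spanned by all $v\wedge w$. Here $V=\mathbb{R}$ is regarded as a vector space over $F=\mathbb{Q}$. *)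

theory Defs
  imports
    Complex_Main
    "HOL-Library.Poly_Mapping"
    "HOL-Algebra.Bij"
    "HOL-Algebra.Generated_Groups"
begin

(* Following HOL-Algebra's BijGroup, maps on [p,q) are functions real => real that are
   undefined outside [p,q), so that equality of maps is equality of functions. *)

definition interval_exchange :: "real \<Rightarrow> real \<Rightarrow> (real \<Rightarrow> real) \<Rightarrow> bool" where
  "interval_exchange p q f \<longleftrightarrow>
     f \<in> Bij {p..<q} \<and>
     (\<exists>(k::nat) (t::nat \<Rightarrow> real).
        t 0 = p \<and> t k = q \<and> (\<forall>i<k. t i < t (Suc i)) \<and>
        (\<forall>i<k. \<exists>c. \<forall>x\<in>{t i..<t (Suc i)}. f x = x + c))"

definition IET_group :: "real \<Rightarrow> real \<Rightarrow> (real \<Rightarrow> real) monoid" where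
  "IET_group p q = (BijGroup {p..<q})\<lparr>carrier := {f. interval_exchange p q f}\<rparr>"

(* The reals tensored with themselves over the rationals: the free rational vector space on
   pairs of reals, modulo the subspace spanned by the bilinearity relators. *)

type_synonym free_pairs = "(real \<times> real) \<Rightarrow>\<^sub>0 rat"

definition free_scale :: "rat \<Rightarrow> free_pairs \<Rightarrow> free_pairs" where
  "free_scale c x = Poly_Mapping.map ((*) c) x"

abbreviation pair_gen :: "real \<Rightarrow> real \<Rightarrow> free_pairs" where
  "pair_gen v w \<equiv> Poly_Mapping.single (v, w) 1"

definition bilinear_relators :: "free_pairs set" where
  "bilinear_relators =
     {pair_gen (v + v') w - pair_gen v w - pair_gen v' w | v v' w. True} \<union>
     {pair_gen v (w + w') - pair_gen v w - pair_gen v w' | v w w'. True} \<union>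
     {pair_gen (of_rat c * v) w - free_scale c (pair_gen v w) | c v w. True} \<union>
     {pair_gen v (of_rat c * w) - free_scale c (pair_gen v w) | c v w. True}"

definition bilinear_null :: "free_pairs set" where
  "bilinear_null = module.span free_scale bilinear_relators"

lemma lookup_free_scale [simp]:
  "Poly_Mapping.lookup (free_scale c x) k = c * Poly_Mapping.lookup x k"
  by (simp add: free_scale_def Poly_Mapping.map.rep_eq when_def)

lemma vector_space_free_scale: "vector_space free_scale"
  by unfold_locales (auto intro!: poly_mapping_eqI simp: lookup_add algebra_simps)

interpretation free_pairs: vector_space free_scale
  by (rule vector_space_free_scale)

lemma bilinear_null_zero: "0 \<in> bilinear_null"
  and bilinear_null_add: "x \<in> bilinear_null \<Longrightarrow> y \<in> bilinear_null \<Longrightarrow> x + y \<in> bilinear_null"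
  and bilinear_null_minus: "x \<in> bilinear_null \<Longrightarrow> - x \<in> bilinear_null"
  and bilinear_null_diff: "x \<in> bilinear_null \<Longrightarrow> y \<in> bilinear_null \<Longrightarrow> x - y \<in> bilinear_null"
  and bilinear_null_scale: "x \<in> bilinear_null \<Longrightarrow> free_scale c x \<in> bilinear_null"
  unfolding bilinear_null_def
  by (auto intro: free_pairs.span_zero free_pairs.span_add free_pairs.span_neg
        free_pairs.span_diff free_pairs.span_scale)

definition tensor_eq :: "free_pairs \<Rightarrow> free_pairs \<Rightarrow> bool" where
  "tensor_eq x y \<longleftrightarrow> x - y \<in> bilinear_null"

lemma equivp_tensor_eq: "equivp tensor_eq"
proof (rule equivpI)
  show "reflp tensor_eq"
    by (simp add: reflp_def tensor_eq_def bilinear_null_zero)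
  show "symp tensor_eq"
    unfolding symp_def tensor_eq_def using bilinear_null_minus by fastforce
  show "transp tensor_eq"
    unfolding transp_def tensor_eq_def using bilinear_null_add by fastforce
qed

quotient_type real_tensor = free_pairs / tensor_eq
  by (rule equivp_tensor_eq)

instantiation real_tensor :: ab_group_add
begin

lift_definition zero_real_tensor :: real_tensor is 0 .

lift_definition plus_real_tensor :: "real_tensor \<Rightarrow> real_tensor \<Rightarrow> real_tensor" is "(+)"
  unfolding tensor_eq_def using bilinear_null_add by (metis add_diff_add)

lift_definition uminus_real_tensor :: "real_tensor \<Rightarrow> real_tensor" is uminus
  unfolding tensor_eq_def using bilinear_null_minus by (metis minus_diff_minus)

lift_definition minus_real_tensor :: "real_tensor \<Rightarrow> real_tensor \<Rightarrow> real_tensor" is "(-)"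
proof -
  fix a b c d assume "tensor_eq a b" "tensor_eq c d"
  then have "(a - b) - (c - d) \<in> bilinear_null"
    unfolding tensor_eq_def by (rule bilinear_null_diff)
  then show "tensor_eq (a - c) (b - d)"
    unfolding tensor_eq_def by (simp add: algebra_simps)
qed

instance
  by standard (transfer; simp add: tensor_eq_def bilinear_null_zero algebra_simps)+

end

lift_definition tensor_scale :: "rat \<Rightarrow> real_tensor \<Rightarrow> real_tensor" is free_scale
  unfolding tensor_eq_def
  by (metis bilinear_null_scale free_pairs.scale_right_diff_distrib)

lift_definition tensor :: "real \<Rightarrow> real \<Rightarrow> real_tensor" is pair_gen .

lemma vector_space_tensor_scale: "vector_space tensor_scale"
  by unfold_locales
    (transfer; simp add: tensor_eq_def bilinear_null_zero
       free_pairs.scale_right_distrib free_pairs.scale_left_distrib)+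

lemma tensor_add_left: "tensor (v + v') w = tensor v w + tensor v' w"
  and tensor_add_right: "tensor v (w + w') = tensor v w + tensor v w'"
  and tensor_scale_left: "tensor (of_rat c * v) w = tensor_scale c (tensor v w)"
  and tensor_scale_right: "tensor v (of_rat c * w) = tensor_scale c (tensor v w)"
  by (transfer,
      unfold tensor_eq_def bilinear_null_def bilinear_relators_def diff_diff_eq[symmetric],
      rule free_pairs.span_base, blast)+

definition wedge :: "real \<Rightarrow> real \<Rightarrow> real_tensor" where
  "wedge v w = tensor v w - tensor w v"

definition wedge_space :: "real_tensor set" where
  "wedge_space = module.span tensor_scale {wedge v w | v w. True}"

definition wedge_group :: "real_tensor monoid" where
  "wedge_group = \<lparr>carrier = wedge_space, monoid.mult = (+), one = 0\<rparr>"

end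

theory Submission
  imports Defs "HOL-Algebra.FiniteProduct" "HOL-Analysis.Lebesgue_Measure"
begin

text \<open>
  The isomorphism is induced by the Sah-Arnoux-Fathi invariant, which sends an exchange of intervals
  of lengths \<open>\<lambda>\<^sub>i\<close> by translations \<open>\<tau>\<^sub>i\<close> to \<open>\<Sum> \<lambda>\<^sub>i \<otimes> \<tau>\<^sub>i\<close>. It is the integral of the displacement
  \<open>f x - x\<close>, and since interval exchanges preserve measure it is a homomorphism
  (\<open>SAF_invariant_compose\<close>).

  Every interval exchange is a product of swaps of two adjacent intervals
  (\<open>exchange_generated_by_swaps\<close>), and the invariant of a swap of intervals of lengths \<open>s\<close> and \<open>t\<close> is
  \<open>s \<otimes> t - t \<otimes> s\<close>. Hence all values are in the space of wedges. All of this space is reached,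
  because bilinearity reduces every wedge to wedges of short vectors (\<open>SAF_surjective\<close>).

  It remains to see that the kernel is no larger than the commutator group. Let \<open>\<rho> s t\<close> be the class,
  in the abelianization, of a swap of intervals of lengths \<open>s\<close> and \<open>t\<close>. It does not depend on the
  position of the intervals, because swaps at different positions are conjugate. Moving an interval
  past two others one at a time shows that \<open>\<rho>\<close> is additive in each argument, and exchanging two
  intervals back shows \<open>\<rho> t s = - \<rho> s t\<close>. So \<open>\<rho>\<close>, which is defined only for small arguments, extends to
  a biadditive map on all pairs of reals. Biadditive maps on the reals are automatically balanced over
  the rationals, so they factor through the tensor square, and this gives a homomorphism \<open>\<Phi>\<close> from
  the wedges to the abelianization with \<open>\<Phi> (s \<otimes> t - t \<otimes> s) = \<rho> s t\<close> (\<open>wedge_universal\<close>). The composition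
  of \<open>\<Phi>\<close> with the invariant agrees with the quotient map on swaps, hence everywhere
  (\<open>class_factors_through_SAF\<close>), and an exchange with zero invariant has trivial class.
\<close>

section \<open>Locally biadditive maps and the tensor square\<close>

lemma floor_remainder_bounds:
  fixes x e :: real
  assumes "0 < e"
  shows "0 \<le> x - of_int \<lfloor>x / e\<rfloor> * e" "x - of_int \<lfloor>x / e\<rfloor> * e < e"
  using assms floor_divide_lower[of e x] floor_divide_upper[of e x] by (auto simp: algebra_simps)

context comm_group
begin

text \<open>
  Additivity is only demanded of sums that stay in the interval: the swaps of two intervals of
  lengths \<open>s\<close> and \<open>t\<close> exist only while both fit into the given interval.
\<close>
definition additive_on :: "real \<Rightarrow> (real \<Rightarrow> 'a) \<Rightarrow> bool" where
  "additive_on e \<alpha> \<longleftrightarrow> \<alpha> \<in> {0..e} \<rightarrow> carrier G \<and>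
     (\<forall>x\<ge>0. \<forall>y\<ge>0. x + y \<le> e \<longrightarrow> \<alpha> (x + y) = \<alpha> x \<otimes> \<alpha> y)"

text \<open>
  The additive extension of \<open>\<alpha>\<close> from \<open>{0..e}\<close> to the whole line, found by dividing by \<open>e\<close> with
  remainder.
\<close>
definition extend :: "real \<Rightarrow> (real \<Rightarrow> 'a) \<Rightarrow> real \<Rightarrow> 'a" where
  "extend e \<alpha> x = \<alpha> e [^] \<lfloor>x / e\<rfloor> \<otimes> \<alpha> (x - of_int \<lfloor>x / e\<rfloor> * e)"

lemma additive_on_closed: "additive_on e \<alpha> \<Longrightarrow> 0 \<le> x \<Longrightarrow> x \<le> e \<Longrightarrow> \<alpha> x \<in> carrier G"
  by (auto simp: additive_on_def)

lemma additive_on_add: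
  "additive_on e \<alpha> \<Longrightarrow> 0 \<le> x \<Longrightarrow> 0 \<le> y \<Longrightarrow> x + y \<le> e \<Longrightarrow> \<alpha> (x + y) = \<alpha> x \<otimes> \<alpha> y"
  by (auto simp: additive_on_def)

lemma additive_on_zero:
  assumes "additive_on e \<alpha>" "0 < e"
  shows "\<alpha> 0 = \<one>"
proof -
  have "\<alpha> 0 \<in> carrier G" "\<alpha> 0 = \<alpha> 0 \<otimes> \<alpha> 0"
    using additive_on_closed[OF assms(1), of 0] additive_on_add[OF assms(1), of 0 0] assms(2) by auto
  then show ?thesis
    using r_cancel_one by metis
qed

lemma extend_closed:
  assumes "\<alpha> \<in> {0..e} \<rightarrow> carrier G" "0 < e"
  shows "extend e \<alpha> x \<in> carrier G"
proof -
  have "\<alpha> e \<in> carrier G" "\<alpha> (x - of_int \<lfloor>x / e\<rfloor> * e) \<in> carrier G"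
    using assms floor_remainder_bounds[OF assms(2), of x] by (auto simp: Pi_iff)
  then show ?thesis
    by (simp add: extend_def)
qed

lemma extend_cong:
  assumes "\<And>x. 0 \<le> x \<Longrightarrow> x \<le> e \<Longrightarrow> \<alpha> x = \<beta> x" "0 < e"
  shows "extend e \<alpha> x = extend e \<beta> x"
  unfolding extend_def
  using assms(1)[of e] assms(1)[of "x - of_int \<lfloor>x / e\<rfloor> * e"] assms(2)
    floor_remainder_bounds[OF assms(2), of x] by simp

lemma extend_mult:
  assumes "\<alpha> \<in> {0..e} \<rightarrow> carrier G" "\<beta> \<in> {0..e} \<rightarrow> carrier G" "0 < e"
  shows "extend e (\<lambda>s. \<alpha> s \<otimes> \<beta> s) x = extend e \<alpha> x \<otimes> extend e \<beta> x"
proof -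
  have "\<alpha> e \<in> carrier G" "\<alpha> (x - of_int \<lfloor>x / e\<rfloor> * e) \<in> carrier G"
    "\<beta> e \<in> carrier G" "\<beta> (x - of_int \<lfloor>x / e\<rfloor> * e) \<in> carrier G"
    using assms floor_remainder_bounds[OF assms(3), of x] by (auto simp: Pi_iff)
  then show ?thesis
    by (simp add: extend_def int_pow_distrib m_ac)
qed

lemma extend_eq:
  assumes "additive_on e \<alpha>" "0 < e" "0 \<le> x" "x \<le> e"
  shows "extend e \<alpha> x = \<alpha> x"
proof (cases "x = e")
  case True
  then show ?thesis
    using assms additive_on_zero[OF assms(1,2)] additive_on_closed[OF assms(1), of e]
    by (simp add: extend_def)
next
  case False
  then have "\<lfloor>x / e\<rfloor> = 0"
    using assms by (simp add: floor_eq_iff)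
  then show ?thesis
    using assms additive_on_closed[OF assms(1), of x] by (simp add: extend_def)
qed

text \<open>
  Without a carry this is the additivity of \<open>\<alpha>\<close> at the two remainders \<open>r\<close> and \<open>s\<close>. When
  \<open>r + s \<ge> e\<close> the sum \<open>r + s\<close> may be outside the domain of \<open>\<alpha>\<close>, and splitting \<open>r\<close> at \<open>e - s\<close> gives
  \<open>\<alpha> r \<otimes> \<alpha> s = \<alpha> e \<otimes> \<alpha> (r + s - e)\<close>, the carried unit.
\<close>
lemma extend_add:
  assumes \<alpha>: "additive_on e \<alpha>" and e: "0 < e"
  shows "extend e \<alpha> (x + y) = extend e \<alpha> x \<otimes> extend e \<alpha> y"
proof -
  define k l where "k = \<lfloor>x / e\<rfloor>" and "l = \<lfloor>y / e\<rfloor>"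
  define r s where "r = x - of_int k * e" and "s = y - of_int l * e"
  have r: "0 \<le> r" "r < e" and s: "0 \<le> s" "s < e"
    using floor_remainder_bounds[OF e] by (auto simp: r_def s_def k_def l_def)
  have x: "x = of_int k * e + r" and y: "y = of_int l * e + s"
    by (auto simp: r_def s_def)
  have cl: "\<alpha> e \<in> carrier G" "\<alpha> r \<in> carrier G" "\<alpha> s \<in> carrier G"
    using additive_on_closed[OF \<alpha>] e r s by auto
  have rhs: "extend e \<alpha> x \<otimes> extend e \<alpha> y = \<alpha> e [^] (k + l) \<otimes> (\<alpha> r \<otimes> \<alpha> s)"
    using cl by (simp add: extend_def k_def[symmetric] l_def[symmetric]
        r_def[symmetric] s_def[symmetric] int_pow_mult m_ac)
  show ?thesis
  proof (cases "r + s < e")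
    case True
    have "\<lfloor>(x + y) / e\<rfloor> = k + l"
      using True r s e by (simp add: x y floor_eq_iff field_simps)
    moreover have "x + y - of_int (k + l) * e = r + s"
      by (simp add: x y algebra_simps)
    ultimately show ?thesis
      using True r s rhs additive_on_add[OF \<alpha>, of r s] by (simp add: extend_def)
  next
    case False
    have "\<lfloor>(x + y) / e\<rfloor> = k + l + 1"
      using False r s e by (simp add: x y floor_eq_iff field_simps)
    moreover have "x + y - of_int (k + l + 1) * e = r + s - e"
      by (simp add: x y algebra_simps)
    ultimately have lhs: "extend e \<alpha> (x + y) = \<alpha> e [^] (k + l + 1) \<otimes> \<alpha> (r + s - e)"
      by (simp add: extend_def)
    have cl': "\<alpha> (r + s - e) \<in> carrier G" "\<alpha> (e - s) \<in> carrier G"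
      using additive_on_closed[OF \<alpha>] False r s by auto
    have "\<alpha> r = \<alpha> (e - s) \<otimes> \<alpha> (r + s - e)"
      using additive_on_add[OF \<alpha>, of "e - s" "r + s - e"] False r s by simp
    moreover have "\<alpha> e = \<alpha> (e - s) \<otimes> \<alpha> s"
      using additive_on_add[OF \<alpha>, of "e - s" s] s by simp
    ultimately have "\<alpha> r \<otimes> \<alpha> s = \<alpha> e \<otimes> \<alpha> (r + s - e)"
      using cl cl' by (simp add: m_ac)
    moreover have "\<alpha> e [^] (k + l + 1) = \<alpha> e [^] (k + l) \<otimes> \<alpha> e"
      using cl int_pow_mult[of "\<alpha> e" "k + l" 1] by simp
    ultimately show ?thesis
      using lhs rhs cl cl' by (simp add: m_assoc)
  qed
qed

definition biadditive_on :: "real \<Rightarrow> (real \<Rightarrow> real \<Rightarrow> 'a) \<Rightarrow> bool" where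
  "biadditive_on e \<rho> \<longleftrightarrow>
     (\<forall>s\<in>{0..e}. additive_on e (\<rho> s) \<and> additive_on e (\<lambda>t. \<rho> t s))"

definition biextend :: "real \<Rightarrow> (real \<Rightarrow> real \<Rightarrow> 'a) \<Rightarrow> real \<Rightarrow> real \<Rightarrow> 'a" where
  "biextend e \<rho> v w = extend e (\<lambda>s. extend e (\<rho> s) w) v"

context
  fixes e :: real and \<rho> :: "real \<Rightarrow> real \<Rightarrow> 'a"
  assumes e: "0 < e" and \<rho>: "biadditive_on e \<rho>"
begin

lemma additive_on_extend: "additive_on e (\<lambda>s. extend e (\<rho> s) w)"
proof -
  have cl: "\<rho> s \<in> {0..e} \<rightarrow> carrier G" if "0 \<le> s" "s \<le> e" for s
    using \<rho> that by (auto simp: biadditive_on_def additive_on_def)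
  have "extend e (\<rho> (x + y)) w = extend e (\<rho> x) w \<otimes> extend e (\<rho> y) w"
    if "0 \<le> x" "0 \<le> y" "x + y \<le> e" for x y
  proof -
    have "\<rho> (x + y) t = \<rho> x t \<otimes> \<rho> y t" if "0 \<le> t" "t \<le> e" for t
      using \<rho> that \<open>0 \<le> x\<close> \<open>0 \<le> y\<close> \<open>x + y \<le> e\<close> by (auto simp: biadditive_on_def additive_on_def)
    then have "extend e (\<rho> (x + y)) w = extend e (\<lambda>t. \<rho> x t \<otimes> \<rho> y t) w"
      by (rule extend_cong) (use e in auto)
    then show ?thesis
      using extend_mult[OF cl cl e, of x y w] that by simp
  qed
  then show ?thesis
    using extend_closed[OF cl e] by (auto simp: additive_on_def)
qed

lemma biextend_closed: "biextend e \<rho> v w \<in> carrier G"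
  unfolding biextend_def
  using additive_on_extend e by (intro extend_closed) (auto simp: additive_on_def)

lemma biextend_add_left: "biextend e \<rho> (v + v') w = biextend e \<rho> v w \<otimes> biextend e \<rho> v' w"
  unfolding biextend_def by (rule extend_add[OF additive_on_extend e])

lemma biextend_add_right: "biextend e \<rho> v (w + w') = biextend e \<rho> v w \<otimes> biextend e \<rho> v w'"
proof -
  have "biextend e \<rho> v (w + w') = extend e (\<lambda>s. extend e (\<rho> s) w \<otimes> extend e (\<rho> s) w') v"
    unfolding biextend_def
    by (rule extend_cong[OF extend_add e]) (use e \<rho> in \<open>auto simp: biadditive_on_def\<close>)
  then show ?thesis
    using additive_on_extend e by (simp add: biextend_def extend_mult additive_on_def)
qed

lemma biextend_eq:
  assumes "0 \<le> s" "s \<le> e" "0 \<le> t" "t \<le> e"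
  shows "biextend e \<rho> s t = \<rho> s t"
  using assms \<rho> e by (simp add: biextend_def extend_eq[OF additive_on_extend] extend_eq biadditive_on_def)

end

lemma additive_int_mult:
  fixes f :: "real \<Rightarrow> 'a"
  assumes cl: "\<And>x. f x \<in> carrier G" and add: "\<And>x y. f (x + y) = f x \<otimes> f y"
  shows "f (of_int n * x) = f x [^] n"
proof -
  have z: "f 0 = \<one>"
    using add[of 0 0] cl[of 0] r_cancel_one by (metis add_0)
  show ?thesis
  proof (induction n rule: int_induct[where k = 0])
    case base
    then show ?case by (simp add: z)
  next
    case (step1 i)
    have "f (of_int (i + 1) * x) = f (of_int i * x) \<otimes> f x"
      using add[of "of_int i * x" x] by (simp add: algebra_simps)
    then show ?case
      using step1 cl int_pow_mult[of "f x" i 1] by simp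
  next
    case (step2 i)
    have "f (of_int i * x) = f (of_int (i - 1) * x) \<otimes> f x"
      using add[of "of_int (i - 1) * x" x] by (simp add: algebra_simps)
    moreover have "f x [^] i = f x [^] (i - 1) \<otimes> f x"
      using cl int_pow_mult[of "f x" "i - 1" 1] by simp
    ultimately show ?case
      using step2 cl by (metis int_pow_closed right_cancel)
  qed
qed

text \<open>
  Writing \<open>c = a / b\<close>, both sides are the \<open>a b\<close>-th power of \<open>B (v / b) (w / b)\<close>. This is why
  additivity over the integers suffices to factor through the tensor product over the rationals,
  although the target group carries no rational scalars.
\<close>
lemma biadditive_rat_balanced:
  fixes B :: "real \<Rightarrow> real \<Rightarrow> 'a"
  assumes cl: "\<And>v w. B v w \<in> carrier G"
    and left: "\<And>v v' w. B (v + v') w = B v w \<otimes> B v' w"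
    and right: "\<And>v w w'. B v (w + w') = B v w \<otimes> B v w'"
  shows "B (of_rat c * v) w = B v (of_rat c * w)"
proof -
  obtain a b where c: "c = Fract a b" and b: "b > 0"
    by (cases c) auto
  define u z where "u = v / of_int b" and "z = w / of_int b"
  have v: "v = of_int b * u" and w: "w = of_int b * z"
    and cv: "of_rat c * v = of_int a * u" and cw: "of_rat c * w = of_int a * z"
    using b by (auto simp: u_def z_def c of_rat_rat)
  have l: "B (of_int n * x) y = B x y [^] n" for n x y
    using additive_int_mult[of "\<lambda>x. B x y"] cl left by simp
  have r: "B x (of_int n * y) = B x y [^] n" for n x y
    using additive_int_mult[of "B x"] cl right by simp
  have "B (of_int a * u) (of_int b * z) = B u z [^] (a * b)"
    using cl by (simp only: l r int_pow_pow)
  moreover have "B (of_int b * u) (of_int a * z) = B u z [^] (b * a)"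
    using cl by (simp only: l r int_pow_pow)
  ultimately show ?thesis
    unfolding cv cw using v w by (simp add: mult.commute)
qed

text \<open>
  The universal property of the tensor square for targets that are merely abelian groups. A formal
  combination \<open>\<Sum> c\<^sub>i (v\<^sub>i, w\<^sub>i)\<close> is sent to the product of the \<open>B (c\<^sub>i v\<^sub>i) w\<^sub>i\<close>: the rational scalars
  are absorbed into the first real argument. Relators are sent to the identity, by
  biadditivity or, for a scalar in the second argument, by \<open>biadditive_rat_balanced\<close>.
\<close>
lemma tensor_universal:
  fixes B :: "real \<Rightarrow> real \<Rightarrow> 'a"
  assumes cl: "\<And>v w. B v w \<in> carrier G"
    and left: "\<And>v v' w. B (v + v') w = B v w \<otimes> B v' w"
    and right: "\<And>v w w'. B v (w + w') = B v w \<otimes> B v w'"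
  obtains \<Phi> :: "real_tensor \<Rightarrow> 'a"
  where "\<And>X. \<Phi> X \<in> carrier G" "\<And>X Y. \<Phi> (X + Y) = \<Phi> X \<otimes> \<Phi> Y"
    "\<And>v w. \<Phi> (tensor v w) = B v w"
proof -
  define summand where "summand x k = B (of_rat (Poly_Mapping.lookup x k) * fst k) (snd k)"
    for x :: free_pairs and k
  define F where "F x = finprod G (summand x) (Poly_Mapping.keys x)" for x
  have B0: "B 0 w = \<one>" for w
    using left[of 0 0 w] cl[of 0 w] r_cancel_one by (metis add_0)
  have summand_cl: "summand x \<in> S \<rightarrow> carrier G" for x S
    by (simp add: summand_def cl)
  have F_superset: "F x = finprod G (summand x) S" if "finite S" "Poly_Mapping.keys x \<subseteq> S" for x S
    unfolding F_def using that summand_cl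
    by (intro finprod_mono_neutral_cong_left) (auto simp: summand_def in_keys_iff B0)
  have F_cl: "F x \<in> carrier G" for x
    by (simp add: F_def summand_cl)
  have F_add: "F (x + y) = F x \<otimes> F y" for x y
  proof -
    let ?S = "Poly_Mapping.keys x \<union> Poly_Mapping.keys y"
    have "F (x + y) = finprod G (summand (x + y)) ?S"
      by (rule F_superset) (simp_all add: keys_add)
    also have "\<dots> = finprod G (\<lambda>k. summand x k \<otimes> summand y k) ?S"
      by (rule finprod_cong') (auto simp: summand_def cl lookup_add of_rat_add algebra_simps left)
    also have "\<dots> = F x \<otimes> F y"
      using summand_cl by (simp add: finprod_multf F_superset[of ?S])
    finally show ?thesis .
  qed
  have F_0: "F 0 = \<one>"
    by (simp add: F_def)
  have F_diff: "F (x - y) = F x \<otimes> inv F y" for x y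
    using F_add[of "x - y" y] F_cl by (simp add: m_assoc)
  have F_single: "F (Poly_Mapping.single (v, w) c) = B (of_rat c * v) w" for v w c
    using F_superset[of "{(v, w)}" "Poly_Mapping.single (v, w) c"]
    by (simp add: summand_def cl)
  have scale_single:
    "free_scale a (Poly_Mapping.single k b) = Poly_Mapping.single k (a * b)" for a b k
    by (rule poly_mapping_eqI) (simp add: lookup_single when_def)
  \<comment> \<open>The span is rational, so rational multiples of relators have to be killed as well.\<close>
  have F_relator: "F (free_scale c x) = \<one>" if "x \<in> bilinear_relators" for c x
  proof -
    have bal: "B (of_rat d * (of_rat d' * v)) w = B (of_rat d * v) (of_rat d' * w)" for d d' v w
      using biadditive_rat_balanced[of B d' "of_rat d * v" w] cl left right
      by (simp add: mult.left_commute)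
    have canc: "x \<otimes> y \<otimes> inv x \<otimes> inv y = \<one>" if "x \<in> carrier G" "y \<in> carrier G" for x y
      using that by (metis inv_closed inv_mult m_assoc m_closed r_inv)
    show ?thesis
      using that unfolding bilinear_relators_def
      by (auto simp: free_pairs.scale_right_diff_distrib F_diff scale_single F_single cl
          distrib_left left right of_rat_mult mult.assoc bal[symmetric] canc)
  qed
  have F_null: "F x = \<one>" if "x \<in> bilinear_null" for x
    using that unfolding bilinear_null_def
    by (induction rule: free_pairs.span_induct_alt) (simp_all add: F_0 F_add F_relator)
  have F_eq: "F x = F y" if "tensor_eq x y" for x y
  proof -
    have "F x = F (x - y) \<otimes> F y"
      by (simp flip: F_add)
    then show ?thesis
      using that F_null F_cl by (simp add: tensor_eq_def)
  qed
  define \<Phi> where "\<Phi> X = F (rep_real_tensor X)" for X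
  have \<Phi>_abs: "\<Phi> (abs_real_tensor x) = F x" for x
    unfolding \<Phi>_def by (metis F_eq Quotient3_rep_abs Quotient3_real_tensor equivp_reflp equivp_tensor_eq)
  show ?thesis
  proof
    show "\<Phi> X \<in> carrier G" for X
      by (simp add: \<Phi>_def F_cl)
    show "\<Phi> (X + Y) = \<Phi> X \<otimes> \<Phi> Y" for X Y
      by (induction X, induction Y) (simp add: plus_real_tensor.abs_eq \<Phi>_abs F_add)
    show "\<Phi> (tensor v w) = B v w" for v w
      by (simp add: tensor.abs_eq \<Phi>_abs F_single)
  qed
qed

end

section \<open>Interval exchanges as products of interval swaps\<close>

text \<open>
  The exchange of the adjacent intervals \<open>{a..<a + s}\<close> and \<open>{a + s..<a + s + t}\<close>. Empty intervals
  are allowed, in which case the map is the identity; this saves case distinctions later.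
\<close>
definition interval_swap :: "real \<Rightarrow> real \<Rightarrow> real \<Rightarrow> real \<Rightarrow> real \<Rightarrow> real \<Rightarrow> real" where
  "interval_swap p q a s t = (\<lambda>x\<in>{p..<q}.
     if a \<le> x \<and> x < a + s then x + t
     else if a + s \<le> x \<and> x < a + s + t then x - s else x)"

definition interval_swaps :: "real \<Rightarrow> real \<Rightarrow> (real \<Rightarrow> real) set" where
  "interval_swaps p q =
     {interval_swap p q a s t | a s t. p \<le> a \<and> 0 \<le> s \<and> 0 \<le> t \<and> a + s + t \<le> q}"

lemma interval_swap_inverse:
  assumes "p \<le> a" "0 \<le> s" "0 \<le> t" "a + s + t \<le> q"
  shows "compose {p..<q} (interval_swap p q a t s) (interval_swap p q a s t) = (\<lambda>x\<in>{p..<q}. x)"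
  using assms by (auto simp: fun_eq_iff compose_def interval_swap_def)

lemma interval_swap_Bij:
  assumes "p \<le> a" "0 \<le> s" "0 \<le> t" "a + s + t \<le> q"
  shows "interval_swap p q a s t \<in> Bij {p..<q}"
proof -
  have inv: "interval_swap p q a t s (interval_swap p q a s t x) = x"
    "interval_swap p q a s t (interval_swap p q a t s x) = x" if "x \<in> {p..<q}" for x
    using fun_cong[OF interval_swap_inverse[of p a s t q], of x]
      fun_cong[OF interval_swap_inverse[of p a t s q], of x] that assms
    by (simp_all add: compose_def add_ac)
  have "bij_betw (interval_swap p q a s t) {p..<q} {p..<q}"
    by (rule bij_betw_byWitness[where f' = "interval_swap p q a t s"])
      (use inv assms in \<open>auto simp: interval_swap_def\<close>)
  then show ?thesis
    by (simp add: Bij_def interval_swap_def)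
qed

lemma BijGroup_mult: "f \<in> Bij S \<Longrightarrow> g \<in> Bij S \<Longrightarrow> f \<otimes>\<^bsub>BijGroup S\<^esub> g = compose S f g"
  by (simp add: BijGroup_def)

lemma BijGroup_carrier: "carrier (BijGroup S) = Bij S"
  by (simp add: BijGroup_def)

lemma inv_interval_swap:
  assumes "p \<le> a" "0 \<le> s" "0 \<le> t" "a + s + t \<le> q"
  shows "inv\<^bsub>BijGroup {p..<q}\<^esub> interval_swap p q a s t = interval_swap p q a t s"
proof (rule group.inv_equality[OF group_BijGroup])
  have "interval_swap p q a t s \<in> Bij {p..<q}" "interval_swap p q a s t \<in> Bij {p..<q}"
    using assms by (auto intro!: interval_swap_Bij)
  then show "interval_swap p q a t s \<otimes>\<^bsub>BijGroup {p..<q}\<^esub> interval_swap p q a s t = \<one>\<^bsub>BijGroup {p..<q}\<^esub>"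
    using interval_swap_inverse[OF assms] by (simp add: BijGroup_mult) (simp add: BijGroup_def)
qed (use assms in \<open>auto intro!: interval_swap_Bij simp: BijGroup_carrier\<close>)

lemma partition_mono:
  fixes t :: "nat \<Rightarrow> real"
  assumes "\<And>i. i < k \<Longrightarrow> t i < t (Suc i)" "i \<le> j" "j \<le> k"
  shows "t i \<le> t j"
  using assms(2,3)
proof (induction rule: dec_induct)
  case (step n)
  then show ?case
    using assms(1)[of n] by simp
qed simp

lemma partition_cell:
  fixes t :: "nat \<Rightarrow> real"
  assumes "t 0 \<le> x" "x < t k"
  obtains i where "i < k" "t i \<le> x" "x < t (Suc i)"
proof -
  have "\<exists>i<k. t i \<le> x \<and> x < t (Suc i)"
    using assms
  proof (induction k)
    case (Suc k)
    then show ?case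
      by (cases "x < t k") (auto intro: less_SucI)
  qed simp
  then show ?thesis
    using that by blast
qed

text \<open>
  Induction on the number \<open>k\<close> of intervals that may still move, which fill \<open>{t 0..<q}\<close>. Some
  interval \<open>{t i..<t (Suc i)}\<close> is sent to the leftmost place \<open>t 0\<close>. Precomposing with the swap
  that carries \<open>{t 0..<t 0 + l}\<close> to that interval, where \<open>l\<close> is its length, gives an exchange that fixes
  this initial stretch as well, and the \<open>k - 1\<close> other intervals, the first \<open>i\<close> of them moved to the
  right by \<open>l\<close>, fill the rest.
\<close>
lemma exchange_generated_by_swaps:
  assumes "f \<in> Bij {p..<q}" "p \<le> t 0" "t k = q" "\<And>i. i < k \<Longrightarrow> t i < t (Suc i)"
    and "\<And>i. i < k \<Longrightarrow> \<exists>c. \<forall>x\<in>{t i..<t (Suc i)}. f x = x + c"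
    and "\<And>x. x \<in> {p..<t 0} \<Longrightarrow> f x = x"
  shows "f \<in> generate (BijGroup {p..<q}) (interval_swaps p q)"
  using assms
proof (induction k arbitrary: f t)
  case 0
  then have "f = \<one>\<^bsub>BijGroup {p..<q}\<^esub>"
    by (auto simp: BijGroup_def Bij_def extensional_def fun_eq_iff)
  then show ?case
    by (simp add: generate.one)
next
  case (Suc k)
  interpret G: group "BijGroup {p..<q}"
    by (rule group_BijGroup)
  let ?I = "{p..<q}"
  note f = Suc.prems(1)
  have mono: "t i \<le> t j" if "i \<le> j" "j \<le> Suc k" for i j
    using partition_mono[of "Suc k" t i j] Suc.prems(4) that by blast
  have bij: "bij_betw f ?I ?I"
    using f by (simp add: Bij_def)
  have "t 0 < t (Suc k)"
    using Suc.prems(4)[of 0] mono[of 1 "Suc k"] by simp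
  then have a: "t 0 \<in> ?I"
    using Suc.prems by simp
  have ge: "t 0 \<le> f x" if "x \<in> {t 0..<q}" for x
  proof (rule ccontr)
    assume "\<not> t 0 \<le> f x"
    moreover have "f x \<in> ?I" "x \<in> ?I"
      using bij that Suc.prems(2) by (auto simp: bij_betw_def)
    ultimately have "f (f x) = f x" "f x \<noteq> x"
      using Suc.prems(6)[of "f x"] that by auto
    then show False
      using bij \<open>f x \<in> ?I\<close> \<open>x \<in> ?I\<close> by (auto simp: bij_betw_def dest: inj_onD)
  qed
  obtain x where x: "x \<in> ?I" "f x = t 0"
    using bij a unfolding bij_betw_def by (metis imageE)
  have "t 0 \<le> x"
    using x Suc.prems(6)[of x] by force
  then obtain i where i: "i < Suc k" "t i \<le> x" "x < t (Suc i)"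
    using partition_cell[of t x "Suc k"] x Suc.prems(3) by auto
  obtain c where c: "\<forall>x\<in>{t i..<t (Suc i)}. f x = x + c"
    using Suc.prems(5)[OF i(1)] by blast
  have ti: "t 0 \<le> t i" "t (Suc i) \<le> q"
    using mono[of 0 i] mono[of "Suc i" "Suc k"] i Suc.prems(3) by auto
  have "t 0 \<le> f (t i)"
    using ge[of "t i"] i ti by auto
  then have "x = t i"
    using c i x by force
  then have fti: "t i + c = t 0"
    using c x i by force
  define d l where "d = t i - t 0" and "l = t (Suc i) - t i"
  have dl: "0 \<le> d" "0 < l" "t 0 + l + d = t (Suc i)" "t 0 + d = t i"
    using ti i by (auto simp: d_def l_def)
  define \<sigma> where "\<sigma> = interval_swap p q (t 0) l d"
  have \<sigma>: "\<sigma> \<in> Bij ?I"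
    unfolding \<sigma>_def using dl ti Suc.prems(2) by (intro interval_swap_Bij) auto
  have \<sigma>_swap: "\<sigma> \<in> interval_swaps p q"
    unfolding interval_swaps_def \<sigma>_def using dl ti Suc.prems(2) by fastforce
  define g where "g = compose ?I f \<sigma>"
  have g: "g = f \<otimes>\<^bsub>BijGroup ?I\<^esub> \<sigma>"
    using f \<sigma> by (simp add: g_def BijGroup_mult)
  \<comment> \<open>The new endpoints: \<open>t (Suc i) = t i + l\<close>, so the two clauses agree at \<open>j = i\<close>.\<close>
  define s where "s j = (if j < i then t j + l else t (Suc j))" for j
  have s0: "s 0 = t 0 + l"
    using dl by (cases "i = 0") (auto simp: s_def d_def l_def)
  have "g \<in> generate (BijGroup ?I) (interval_swaps p q)"
  proof (rule Suc.IH)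
    show "g \<in> Bij ?I"
      using f \<sigma> by (simp add: g_def compose_Bij)
    show "p \<le> s 0" "s k = q"
      using s0 Suc.prems dl i by (auto simp: s_def)
    show "s j < s (Suc j)" if "j < k" for j
    proof (cases "Suc j = i")
      case True
      then show ?thesis
        using Suc.prems(4)[of j] that i by (simp add: s_def l_def)
    next
      case False
      then show ?thesis
        using Suc.prems(4)[of j] Suc.prems(4)[of "Suc j"] that by (auto simp: s_def)
    qed
    show "g x = x" if "x \<in> {p..<s 0}" for x
    proof (cases "x < t 0")
      case True
      then show ?thesis
        using that Suc.prems(6)[of x] a dl by (simp add: g_def compose_def \<sigma>_def interval_swap_def)
    next
      case False
      then have "f (x + d) = x"
        using c that s0 dl fti by force
      then show ?thesis
        using that False s0 dl ti by (simp add: g_def compose_def \<sigma>_def interval_swap_def)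
    qed
    show "\<exists>c. \<forall>x\<in>{s j..<s (Suc j)}. g x = x + c" if j: "j < k" for j
    proof (cases "j < i")
      case True
      obtain c' where c': "\<forall>x\<in>{t j..<t (Suc j)}. f x = x + c'"
        using Suc.prems(5)[of j] j by auto
      have bounds: "t 0 \<le> t j" "t (Suc j) \<le> t i"
        using mono[of 0 j] mono[of "Suc j" i] True i j by auto
      have "s (Suc j) = t (Suc j) + l"
        using True by (cases "Suc j = i") (auto simp: s_def l_def)
      then have "g x = x + (c' - l)" if "x \<in> {s j..<s (Suc j)}" for x
      proof -
        have x: "t j \<le> x - l" "x - l < t (Suc j)"
          using that True \<open>s (Suc j) = t (Suc j) + l\<close> by (auto simp: s_def)
        then have "\<sigma> x = x - l"
          using bounds dl ti Suc.prems(2) by (simp add: \<sigma>_def interval_swap_def)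
        moreover have "f (x - l) = x - l + c'"
          using c' x by simp
        ultimately show ?thesis
          using x bounds dl ti Suc.prems(2) by (simp add: g_def compose_def)
      qed
      then show ?thesis
        by blast
    next
      case False
      obtain c' where c': "\<forall>x\<in>{t (Suc j)..<t (Suc (Suc j))}. f x = x + c'"
        using Suc.prems(5)[of "Suc j"] j by auto
      have bounds: "t (Suc i) \<le> t (Suc j)" "t (Suc (Suc j)) \<le> q"
        using mono[of "Suc i" "Suc j"] mono[of "Suc (Suc j)" "Suc k"] False i j Suc.prems(3) by auto
      have "g x = x + c'" if "x \<in> {s j..<s (Suc j)}" for x
        using that False c' bounds dl Suc.prems(2)
        by (simp add: s_def g_def compose_def \<sigma>_def interval_swap_def)
      then show ?thesis
        by blast
    qed
  qed
  moreover have "f = g \<otimes>\<^bsub>BijGroup ?I\<^esub> inv\<^bsub>BijGroup ?I\<^esub> \<sigma>"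
    using f \<sigma> unfolding g BijGroup_carrier[symmetric] by (simp add: G.m_assoc)
  ultimately show ?case
    using \<sigma>_swap by (auto intro: generate.eng generate.inv)
qed

text \<open>
  Interval exchanges described by a finite set of possible discontinuities instead of an ordered
  partition. Such sets may be enlarged freely, which makes compositions easy to treat. A break at
  \<open>x\<close> itself is harmless because the pieces are closed on the left.
\<close>
definition translates_off :: "real \<Rightarrow> real \<Rightarrow> real set \<Rightarrow> (real \<Rightarrow> real) \<Rightarrow> bool" where
  "translates_off p q P f \<longleftrightarrow>
     (\<forall>x\<in>{p..<q}. \<forall>y\<in>{p..<q}. x < y \<longrightarrow> {x<..y} \<inter> P = {} \<longrightarrow> f y - f x = y - x)"

lemma translates_offD:
  assumes "translates_off p q P f" "p \<le> x" "x < y" "y < q" "{x<..y} \<inter> P = {}"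
  shows "f y = f x + (y - x)"
proof -
  have "f y - f x = y - x"
    using assms unfolding translates_off_def by simp
  then show ?thesis
    by simp
qed

lemma interval_exchange_breaks:
  assumes "interval_exchange p q f"
  obtains P where "finite P" "translates_off p q P f"
proof -
  obtain k t where t: "t 0 = p" "t k = q" "\<forall>i<k. t i < t (Suc i)"
    and c: "\<forall>i<k. \<exists>c. \<forall>x\<in>{t i..<t (Suc i)}. f x = x + c"
    using assms unfolding interval_exchange_def by auto
  have "f y - f x = y - x"
    if xy: "x \<in> {p..<q}" "y \<in> {p..<q}" "x < y" "{x<..y} \<inter> t ` {..k} = {}" for x y
  proof -
    obtain i where i: "i < k" "t i \<le> x" "x < t (Suc i)"
      using partition_cell[of t x k] t xy by auto
    have "t (Suc i) \<notin> {x<..y}"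
      using xy(4) i by (metis Suc_leI atMost_iff disjoint_iff image_eqI)
    then have "y < t (Suc i)"
      using i by auto
    then show ?thesis
      using c i xy by force
  qed
  then have "translates_off p q (t ` {..k}) f"
    unfolding translates_off_def by blast
  then show ?thesis
    using that by blast
qed

lemma interval_exchangeI:
  assumes f: "f \<in> Bij {p..<q}" and P: "finite P" and tr: "translates_off p q P f" and "p < q"
  shows "interval_exchange p q f"
proof -
  define S where "S = {p, q} \<union> (P \<inter> {p..q})"
  define xs where "xs = sorted_list_of_set S"
  define k where "k = length xs - 1"
  have "finite S"
    using P by (simp add: S_def)
  then have S: "finite S" "set xs = S"
    by (simp_all add: xs_def)
  have lt: "xs ! i < xs ! j" if "i < j" "j < length xs" for i j
    using sorted_wrt_nth_less[of "(<)" xs i j] that by (simp add: xs_def)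
  have len: "Suc k = length xs"
    using S by (cases xs) (auto simp: k_def S_def)
  have S_nth: "xs ! i \<in> S" if "i \<le> k" for i
    using S len that by (metis less_Suc_eq_le nth_mem)
  obtain i where i: "i \<le> k" "xs ! i = p"
    using S len by (metis in_set_conv_nth less_Suc_eq_le UnI1 S_def insertI1)
  obtain j where j: "j \<le> k" "xs ! j = q"
    using S len by (metis in_set_conv_nth less_Suc_eq_le UnI1 S_def insertI1 insertI2)
  have bounds: "p \<le> z" "z \<le> q" if "z \<in> S" for z
    using that \<open>p < q\<close> by (auto simp: S_def)
  have "i = 0"
    using lt[of 0 i] i len bounds(1)[OF S_nth[of 0]] by (cases "i = 0") simp_all
  moreover have "j = k"
    using lt[of j k] j len bounds(2)[OF S_nth[of k]] by (cases "j = k") simp_all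
  ultimately have ends: "xs ! 0 = p" "xs ! k = q"
    using i j by simp_all
  have "\<exists>c. \<forall>x\<in>{xs ! i..<xs ! Suc i}. f x = x + c" if i: "i < k" for i
  proof -
    have "f x = x + (f (xs ! i) - xs ! i)" if x: "x \<in> {xs ! i..<xs ! Suc i}" for x
    proof (cases "x = xs ! i")
      case False
      have I: "xs ! i \<in> {p..<q}" "x \<in> {p..<q}"
        using x S_nth[of i] S_nth[of "Suc i"] i \<open>p < q\<close> by (auto simp: S_def)
      have "{xs ! i<..x} \<inter> P = {}"
      proof (rule ccontr)
        assume "{xs ! i<..x} \<inter> P \<noteq> {}"
        then obtain z where z: "z \<in> P" "xs ! i < z" "z \<le> x"
          by auto
        then have "z \<in> set xs"
          using I S by (auto simp: S_def)
        then obtain j where j: "j < length xs" "z = xs ! j"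
          by (auto simp: in_set_conv_nth)
        have "\<not> j < i" "j \<noteq> i" "\<not> Suc i < j" "j \<noteq> Suc i"
          using lt[of j i] lt[of "Suc i" j] z x j i len by auto
        then show False
          by simp
      qed
      then show ?thesis
        using translates_offD[OF tr, of "xs ! i" x] I x False by simp
    qed simp
    then show ?thesis
      by blast
  qed
  then show ?thesis
    unfolding interval_exchange_def using f ends lt len
    by (intro conjI exI[of _ k] exI[of _ "(!) xs"]) auto
qed

lemma interval_exchange_swap:
  assumes "p < q" "p \<le> a" "0 \<le> s" "0 \<le> t" "a + s + t \<le> q"
  shows "interval_exchange p q (interval_swap p q a s t)"
proof (rule interval_exchangeI[where P = "{a, a + s, a + s + t}"])
  show "translates_off p q {a, a + s, a + s + t} (interval_swap p q a s t)"
    unfolding translates_off_def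
  proof (intro ballI impI)
    fix x y assume xy: "x \<in> {p..<q}" "y \<in> {p..<q}" "x < y"
      and off: "{x<..y} \<inter> {a, a + s, a + s + t} = {}"
    have "a \<le> x \<or> y < a" "a + s \<le> x \<or> y < a + s" "a + s + t \<le> x \<or> y < a + s + t"
      using off by auto
    then show "interval_swap p q a s t y - interval_swap p q a s t x = y - x"
      using xy assms by (auto simp: interval_swap_def)
  qed
qed (use assms in \<open>simp_all add: interval_swap_Bij\<close>)

text \<open>
  A break of the composition is a break of \<open>g\<close> or a point that \<open>g\<close> sends to a break of \<open>f\<close>.
\<close>
lemma interval_exchange_compose:
  assumes f: "interval_exchange p q f" and g: "interval_exchange p q g" and "p < q"
  shows "interval_exchange p q (compose {p..<q} f g)"
proof -
  obtain P Q where P: "finite P" "translates_off p q P f" and Q: "finite Q" "translates_off p q Q g"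
    using interval_exchange_breaks f g by metis
  have bij: "f \<in> Bij {p..<q}" "g \<in> Bij {p..<q}"
    using f g by (auto simp: interval_exchange_def)
  have maps: "g x \<in> {p..<q}" if "x \<in> {p..<q}" for x
    using bij(2) that by (auto simp: Bij_def bij_betw_def)
  have inj: "inj_on g {p..<q}"
    using bij(2) by (auto simp: Bij_def bij_betw_def)
  let ?R = "Q \<union> (g -` P \<inter> {p..<q})"
  have "f (g y) - f (g x) = y - x"
    if xy: "x \<in> {p..<q}" "y \<in> {p..<q}" "x < y" and R: "{x<..y} \<inter> ?R = {}" for x y
  proof -
    have tr: "g z = g x + (z - x)" if "x < z" "z \<le> y" for z
    proof -
      have "{x<..z} \<subseteq> {x<..y}"
        using that by auto
      then have "{x<..z} \<inter> Q = {}"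
        using R by blast
      then show ?thesis
        using translates_offD[OF Q(2), of x z] xy that by simp
    qed
    have "{g x<..g y} \<inter> P = {}"
    proof (rule ccontr)
      assume "{g x<..g y} \<inter> P \<noteq> {}"
      then obtain w where w: "w \<in> P" "g x < w" "w \<le> g y"
        by auto
      let ?z = "x + (w - g x)"
      have "x < ?z" "?z \<le> y"
        using w tr[of y] xy by auto
      then have "?z \<in> {x<..y}" "g ?z = w" "?z \<in> {p..<q}"
        using tr[of ?z] xy by auto
      then show False
        using R w by blast
    qed
    then have "f (g y) - f (g x) = g y - g x"
      using translates_offD[OF P(2), of "g x" "g y"] maps[OF xy(1)] maps[OF xy(2)] tr[of y] xy
      by simp
    then show ?thesis
      using tr[of y] xy by simp
  qed
  then have "translates_off p q ?R (compose {p..<q} f g)"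
    by (auto simp: translates_off_def compose_def)
  moreover have "finite ?R"
    using P(1) Q(1) inj by (auto intro: finite_vimage_IntI)
  ultimately show ?thesis
    using interval_exchangeI compose_Bij bij \<open>p < q\<close> by blast
qed

text \<open>
  In particular the interval exchanges form a group: closure under inverses comes for free, since
  the inverse of a swap is a swap.
\<close>
lemma interval_exchanges_eq_generate:
  assumes "p < q"
  shows "{f. interval_exchange p q f} = generate (BijGroup {p..<q}) (interval_swaps p q)"
proof (intro equalityI subsetI)
  fix f assume "f \<in> {f. interval_exchange p q f}"
  then show "f \<in> generate (BijGroup {p..<q}) (interval_swaps p q)"
    unfolding interval_exchange_def by (auto intro: exchange_generated_by_swaps)
next
  fix f assume "f \<in> generate (BijGroup {p..<q}) (interval_swaps p q)"
  then show "f \<in> {f. interval_exchange p q f}"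
  proof induction
    case one
    have "\<one>\<^bsub>BijGroup {p..<q}\<^esub> = interval_swap p q p 0 0"
      by (auto simp: BijGroup_def interval_swap_def fun_eq_iff)
    then show ?case
      using assms by (simp add: interval_exchange_swap)
  next
    case (incl h)
    then show ?case
      using assms by (auto simp: interval_swaps_def intro: interval_exchange_swap)
  next
    case (inv h)
    then show ?case
      using assms by (auto simp: interval_swaps_def inv_interval_swap intro!: interval_exchange_swap)
  next
    case (eng f g)
    then show ?case
      using assms interval_exchange_compose
      by (auto simp: interval_exchange_def BijGroup_mult)
  qed
qed

section \<open>The Sah-Arnoux-Fathi invariant\<close>

interpretation tensor_space: vector_space tensor_scale
  by (rule vector_space_tensor_scale)

lemma tensor_zero_left [simp]: "tensor 0 w = 0"
  and tensor_zero_right [simp]: "tensor v 0 = 0"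
  using tensor_add_left[of 0 0 w] tensor_add_right[of v 0 0] by simp_all

lemma tensor_minus_left: "tensor (- v) w = - tensor v w"
  and tensor_minus_right: "tensor v (- w) = - tensor v w"
  using tensor_add_left[of "- v" v w] tensor_add_right[of v "- w" w]
  by (simp_all add: eq_neg_iff_add_eq_0)

lemma tensor_sum_left: "tensor (\<Sum>i\<in>A. f i) w = (\<Sum>i\<in>A. tensor (f i) w)"
  by (induction A rule: infinite_finite_induct) (simp_all add: tensor_add_left)

text \<open>
  The integral \<open>\<integral> dx \<otimes> \<phi> x\<close> of a function with finitely many values, the measure of each level set
  being tensored with the value.
\<close>
definition tensor_integral :: "real set \<Rightarrow> (real \<Rightarrow> real) \<Rightarrow> real_tensor" where
  "tensor_integral I \<phi> = (\<Sum>c\<in>\<phi> ` I. tensor (measure lebesgue {x\<in>I. \<phi> x = c}) c)"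

definition finite_valued_on :: "real set \<Rightarrow> (real \<Rightarrow> 'b) \<Rightarrow> bool" where
  "finite_valued_on I \<theta> \<longleftrightarrow> finite (\<theta> ` I) \<and> (\<forall>b. {x\<in>I. \<theta> x = b} \<in> sets lebesgue)"

lemma measure_finite_partition:
  assumes "E \<in> lmeasurable" "finite S" "\<And>i. i \<in> S \<Longrightarrow> A i \<in> sets lebesgue"
    and "disjoint_family_on A S" "E = (\<Union>i\<in>S. A i)"
  shows "measure lebesgue E = (\<Sum>i\<in>S. measure lebesgue (A i))"
proof -
  have "emeasure lebesgue (A i) \<noteq> \<infinity>" if "i \<in> S" for i
  proof -
    have "A i \<in> lmeasurable"
      using assms(3,5) that by (intro fmeasurableI2[OF assms(1)]) auto
    then show ?thesis
      by (auto simp: fmeasurable_def)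
  qed
  then show ?thesis
    unfolding assms(5) using assms(2-4) by (intro measure_finite_Union) auto
qed

text \<open>
  The integral may be computed from any finer finite labelling \<open>\<theta>\<close> of the points, as measures of
  disjoint sets add up in the left factor. Both the additivity of the integral and its value on swaps are
  obtained by choosing a suitable labelling.
\<close>
lemma tensor_integral_eq:
  assumes I: "I \<in> lmeasurable" and \<theta>: "finite_valued_on I \<theta>" and B: "finite B" "\<theta> ` I \<subseteq> B"
  shows "tensor_integral I (\<lambda>x. h (\<theta> x)) = (\<Sum>b\<in>B. tensor (measure lebesgue {x\<in>I. \<theta> x = b}) (h b))"
proof -
  let ?m = "\<lambda>b. measure lebesgue {x\<in>I. \<theta> x = b}"
  have fin: "finite (\<theta> ` I)"
    using B finite_subset by blast
  have "{x\<in>I. \<theta> x = b} = {}" if "b \<in> B - \<theta> ` I" for b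
    using that by auto
  then have "(\<Sum>b\<in>B. tensor (?m b) (h b)) = (\<Sum>b\<in>\<theta> ` I. tensor (?m b) (h b))"
    using B by (intro sum.mono_neutral_right) (auto simp del: Collect_empty_eq)
  also have "\<dots> = (\<Sum>c\<in>h ` \<theta> ` I. \<Sum>b\<in>{b\<in>\<theta> ` I. h b = c}. tensor (?m b) (h b))"
    by (rule sum.image_gen[OF fin])
  also have "\<dots> = (\<Sum>c\<in>h ` \<theta> ` I. tensor (measure lebesgue {x\<in>I. h (\<theta> x) = c}) c)"
  proof (rule sum.cong[OF refl])
    fix c
    let ?S = "{b\<in>\<theta> ` I. h b = c}"
    have E: "{x\<in>I. h (\<theta> x) = c} = (\<Union>b\<in>?S. {x\<in>I. \<theta> x = b})"
      by auto
    have sets: "{x\<in>I. \<theta> x = b} \<in> sets lebesgue" for b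
      using \<theta> by (simp add: finite_valued_on_def)
    have S: "finite ?S"
      using fin by simp
    have "{x\<in>I. h (\<theta> x) = c} \<in> sets lebesgue"
      unfolding E using sets by (intro sets.finite_UN[OF S])
    from fmeasurableI2[OF I _ this] have "{x\<in>I. h (\<theta> x) = c} \<in> lmeasurable"
      by auto
    then have "measure lebesgue {x\<in>I. h (\<theta> x) = c} = (\<Sum>b\<in>?S. ?m b)"
      by (rule measure_finite_partition[OF _ S sets _ E]) (auto simp: disjoint_family_on_def)
    then show "(\<Sum>b\<in>?S. tensor (?m b) (h b)) = tensor (measure lebesgue {x\<in>I. h (\<theta> x) = c}) c"
      by (simp add: tensor_sum_left)
  qed
  finally show ?thesis
    by (simp add: tensor_integral_def image_image)
qed

lemma finite_valued_on_Pair: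
  assumes "finite_valued_on I \<phi>" "finite_valued_on I \<psi>"
  shows "finite_valued_on I (\<lambda>x. (\<phi> x, \<psi> x))"
proof -
  have "{x\<in>I. (\<phi> x, \<psi> x) = b} = {x\<in>I. \<phi> x = fst b} \<inter> {x\<in>I. \<psi> x = snd b}" for b
    by (cases b) auto
  then have "{x\<in>I. (\<phi> x, \<psi> x) = b} \<in> sets lebesgue" for b
    using assms by (simp only: finite_valued_on_def sets.Int)
  moreover have "finite ((\<lambda>x. (\<phi> x, \<psi> x)) ` I)"
    by (rule finite_subset[of _ "\<phi> ` I \<times> \<psi> ` I"])
      (use assms in \<open>auto simp: finite_valued_on_def\<close>)
  ultimately show ?thesis
    by (simp only: finite_valued_on_def) simp
qed

lemma tensor_integral_add:
  assumes I: "I \<in> lmeasurable" and \<phi>: "finite_valued_on I \<phi>" and \<psi>: "finite_valued_on I \<psi>"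
  shows "tensor_integral I (\<lambda>x. \<phi> x + \<psi> x) = tensor_integral I \<phi> + tensor_integral I \<psi>"
proof -
  let ?\<theta> = "\<lambda>x. (\<phi> x, \<psi> x)"
  note eq = tensor_integral_eq[OF I finite_valued_on_Pair[OF \<phi> \<psi>], of "?\<theta> ` I"]
  have fin: "finite (?\<theta> ` I)"
    using finite_valued_on_Pair[OF \<phi> \<psi>] by (simp add: finite_valued_on_def)
  show ?thesis
    using eq[of fst] eq[of snd] eq[of "\<lambda>z. fst z + snd z"] fin
    by (simp add: tensor_add_right sum.distrib)
qed

definition displacement :: "(real \<Rightarrow> real) \<Rightarrow> real \<Rightarrow> real" where
  "displacement f x = f x - x"

text \<open>
  For an exchange of intervals of lengths \<open>\<lambda>\<^sub>i\<close> by translations \<open>\<tau>\<^sub>i\<close> this is \<open>\<Sum> \<lambda>\<^sub>i \<otimes> \<tau>\<^sub>i\<close>. Using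
  level sets of the displacement makes it independent of the choice of a partition.
\<close>
definition SAF_invariant :: "real \<Rightarrow> real \<Rightarrow> (real \<Rightarrow> real) \<Rightarrow> real_tensor" where
  "SAF_invariant p q f = tensor_integral {p..<q} (displacement f)"

lemma finite_valued_displacement:
  assumes "interval_exchange p q f"
  shows "finite_valued_on {p..<q} (displacement f)"
proof -
  obtain k t where t: "t 0 = p" "t k = q" "\<forall>i<k. t i < t (Suc i)"
    and "\<forall>i<k. \<exists>c. \<forall>x\<in>{t i..<t (Suc i)}. f x = x + c"
    using assms unfolding interval_exchange_def by auto
  then obtain c where c: "\<forall>i<k. \<forall>x\<in>{t i..<t (Suc i)}. f x = x + c i"
    by metis
  have cell: "\<exists>i<k. x \<in> {t i..<t (Suc i)} \<and> displacement f x = c i" if "x \<in> {p..<q}" for x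
    using partition_cell[of t x k] t c that unfolding displacement_def
    by (metis add_diff_cancel_left' atLeastLessThan_iff)
  have "finite (displacement f ` {p..<q})"
  proof (rule finite_subset)
    show "displacement f ` {p..<q} \<subseteq> c ` {..<k}"
      using cell by blast
  qed simp
  moreover have "{x\<in>{p..<q}. displacement f x = b} \<in> sets lebesgue" for b
  proof -
    have sub: "{t i..<t (Suc i)} \<subseteq> {p..<q}" if "i < k" for i
      using partition_mono[of k t 0 i] partition_mono[of k t "Suc i" k] t that by auto
    have "{x\<in>{p..<q}. displacement f x = b} = (\<Union>i\<in>{i. i < k \<and> c i = b}. {t i..<t (Suc i)})"
    proof (intro equalityI subsetI)
      fix x assume "x \<in> {x\<in>{p..<q}. displacement f x = b}"
      then show "x \<in> (\<Union>i\<in>{i. i < k \<and> c i = b}. {t i..<t (Suc i)})"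
        using cell[of x] by auto
    next
      fix x assume "x \<in> (\<Union>i\<in>{i. i < k \<and> c i = b}. {t i..<t (Suc i)})"
      then obtain i where i: "i < k" "c i = b" "x \<in> {t i..<t (Suc i)}"
        by auto
      then show "x \<in> {x\<in>{p..<q}. displacement f x = b}"
        using sub[OF i(1)] c by (auto simp: displacement_def)
    qed
    moreover have "{t i..<t (Suc i)} \<in> sets lebesgue" for i
      by simp
    ultimately show ?thesis
      by (simp only:) (rule sets.finite_UN, simp_all)
  qed
  ultimately show ?thesis
    by (simp add: finite_valued_on_def)
qed

lemma lmeasurable_atLeastLessThan: "{a..<b::real} \<in> lmeasurable"
  by (rule fmeasurableI2[OF lmeasurable_cbox[of a b]]) auto

text \<open>
  On each of the finitely many level sets of its displacement the injection \<open>g\<close> is a translation, so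
  it preserves measure piece by piece.
\<close>
lemma interval_exchange_measure_preserving:
  assumes g: "interval_exchange p q g" and E: "E \<in> sets lebesgue" "E \<subseteq> {p..<q}"
  shows "{x\<in>{p..<q}. g x \<in> E} \<in> sets lebesgue"
    and "measure lebesgue {x\<in>{p..<q}. g x \<in> E} = measure lebesgue E"
proof -
  let ?I = "{p..<q}"
  let ?D = "displacement g ` ?I"
  have bij: "bij_betw g ?I ?I"
    using g by (simp add: interval_exchange_def Bij_def)
  have D: "finite ?D" "\<And>a. {x\<in>?I. displacement g x = a} \<in> sets lebesgue"
    using finite_valued_displacement[OF g] by (auto simp: finite_valued_on_def)
  define A where "A a = {x\<in>?I. displacement g x = a \<and> g x \<in> E}" for a
  have "A a = {x\<in>?I. displacement g x = a} \<inter> (+) (- a) ` E" for a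
    by (force simp: A_def displacement_def)
  then have A: "A a \<in> sets lebesgue" for a
    using D(2) lebesgue_sets_translation[OF E(1), of "- a"] by auto
  then have A': "(+) a ` A a \<in> sets lebesgue" for a
    using lebesgue_sets_translation[of "A a" a] by simp
  have pull: "{x\<in>?I. g x \<in> E} = (\<Union>a\<in>?D. A a)"
    by (auto simp: A_def)
  show sets: "{x\<in>?I. g x \<in> E} \<in> sets lebesgue"
    unfolding pull using A D(1) by (intro sets.finite_UN) auto
  have img: "(+) a ` A a = g ` A a" for a
    by (rule image_cong) (auto simp: A_def displacement_def)
  have push: "E = (\<Union>a\<in>?D. (+) a ` A a)"
    unfolding img
  proof (intro equalityI subsetI)
    fix y assume y: "y \<in> E"
    then obtain x where x: "x \<in> ?I" "y = g x"
      using bij E(2) unfolding bij_betw_def by blast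
    then have "x \<in> A (displacement g x)"
      using y by (simp add: A_def)
    then show "y \<in> (\<Union>a\<in>?D. g ` A a)"
      using x by blast
  qed (auto simp: A_def)
  note I = lmeasurable_atLeastLessThan[of p q]
  have "measure lebesgue {x\<in>?I. g x \<in> E} = (\<Sum>a\<in>?D. measure lebesgue (A a))"
    by (rule measure_finite_partition[OF fmeasurableI2[OF I] D(1) A _ pull])
      (use sets in \<open>auto simp: disjoint_family_on_def A_def\<close>)
  also have "\<dots> = (\<Sum>a\<in>?D. measure lebesgue ((+) a ` A a))"
    by (simp add: measure_translation)
  also have "\<dots> = measure lebesgue E"
  proof (rule measure_finite_partition[symmetric, OF fmeasurableI2[OF I] D(1) A' _ push])
    show "disjoint_family_on (\<lambda>a. (+) a ` A a) ?D"
      unfolding img disjoint_family_on_def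
    proof (intro ballI impI)
      fix a b :: real
      assume "a \<noteq> b"
      then have "A a \<inter> A b = {}" "A a \<subseteq> ?I" "A b \<subseteq> ?I"
        by (auto simp: A_def)
      then show "g ` A a \<inter> g ` A b = {}"
        using bij inj_on_image_Int[of g ?I "A a" "A b"] by (simp add: bij_betw_def)
    qed
  qed (use E in auto)
  finally show "measure lebesgue {x\<in>?I. g x \<in> E} = measure lebesgue E" .
qed

text \<open>
  The cocycle identity \<open>f (g x) - x = (f (g x) - g x) + (g x - x)\<close> splits the integral in two, and
  the first part equals the invariant of \<open>f\<close> because \<open>g\<close> preserves measure.
\<close>
lemma SAF_invariant_compose:
  assumes f: "interval_exchange p q f" and g: "interval_exchange p q g"
  shows "SAF_invariant p q (compose {p..<q} f g) = SAF_invariant p q f + SAF_invariant p q g"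
proof -
  let ?I = "{p..<q}"
  have bij: "bij_betw g ?I ?I"
    using g by (simp add: interval_exchange_def Bij_def)
  then have g_image: "g ` ?I = ?I" and maps: "\<And>x. x \<in> ?I \<Longrightarrow> g x \<in> ?I"
    by (auto simp: bij_betw_def)
  let ?\<psi> = "\<lambda>x. displacement f (g x)"
  have range: "?\<psi> ` ?I = displacement f ` ?I"
    by (simp add: g_image flip: image_image)
  define E where "E b = {y\<in>?I. displacement f y = b}" for b
  have E: "E b \<in> sets lebesgue" "E b \<subseteq> ?I" for b
    using finite_valued_displacement[OF f] by (auto simp: finite_valued_on_def E_def)
  have level: "{x\<in>?I. ?\<psi> x = b} = {x\<in>?I. g x \<in> E b}" for b
    using maps by (auto simp: E_def)
  have \<psi>: "finite_valued_on ?I ?\<psi>"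
    using finite_valued_displacement[OF f] interval_exchange_measure_preserving(1)[OF g E]
    unfolding finite_valued_on_def level range by blast
  have \<psi>_eq: "tensor_integral ?I ?\<psi> = SAF_invariant p q f"
    unfolding tensor_integral_def SAF_invariant_def level range interval_exchange_measure_preserving(2)[OF g E]
    by (simp add: E_def)
  have "SAF_invariant p q (compose ?I f g) = tensor_integral ?I (\<lambda>x. ?\<psi> x + displacement g x)"
    unfolding SAF_invariant_def tensor_integral_def
    by (intro sum.cong image_cong arg_cong2[of _ _ _ _ tensor] arg_cong[of _ _ "measure lebesgue"])
      (auto simp: displacement_def compose_def)
  then show ?thesis
    using tensor_integral_add[OF lmeasurable_atLeastLessThan \<psi> finite_valued_displacement[OF g]] \<psi>_eq
    by (simp add: SAF_invariant_def)
qed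

lemma SAF_invariant_swap:
  assumes "p \<le> a" "0 \<le> s" "0 \<le> t" "a + s + t \<le> q"
  shows "SAF_invariant p q (interval_swap p q a s t) = wedge s t"
proof -
  let ?I = "{p..<q}"
  \<comment> \<open>Labels are used rather than displacements, which need not be distinct if \<open>s\<close> or \<open>t\<close> is zero.\<close>
  define \<theta> :: "real \<Rightarrow> nat" where
    "\<theta> x = (if a \<le> x \<and> x < a + s then 0 else if a + s \<le> x \<and> x < a + s + t then 1 else 2)" for x
  define h where "h b = (if b = 0 then t else if b = 1 then - s else 0)" for b :: nat
  have lev0: "{x\<in>?I. \<theta> x = 0} = {a..<a + s}" and lev1: "{x\<in>?I. \<theta> x = 1} = {a + s..<a + s + t}"
    using assms by (auto simp: \<theta>_def)
  have lev2: "{x\<in>?I. \<theta> x = 2} = ?I - {a..<a + s + t}"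
    using assms by (auto simp: \<theta>_def)
  have img: "\<theta> ` ?I \<subseteq> {0, 1, 2}"
    by (auto simp: \<theta>_def)
  have "{x\<in>?I. \<theta> x = b} \<in> sets lebesgue" for b
  proof (cases "b \<in> {0, 1, 2}")
    case True
    then show ?thesis
      using lev0 lev1 lev2 by auto
  next
    case False
    then have "{x\<in>?I. \<theta> x = b} = {}"
      by (auto simp: \<theta>_def split: if_splits)
    then show ?thesis
      by (simp only: sets.empty_sets)
  qed
  moreover have "finite (\<theta> ` ?I)"
    using img finite_subset by blast
  ultimately have \<theta>: "finite_valued_on ?I \<theta>"
    by (simp add: finite_valued_on_def)
  have "SAF_invariant p q (interval_swap p q a s t) = tensor_integral ?I (\<lambda>x. h (\<theta> x))"
    unfolding SAF_invariant_def tensor_integral_def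
    by (intro sum.cong image_cong arg_cong2[of _ _ _ _ tensor] arg_cong[of _ _ "measure lebesgue"])
      (auto simp: displacement_def interval_swap_def h_def \<theta>_def)
  also have "\<dots> = (\<Sum>b\<in>{0, 1, 2}. tensor (measure lebesgue {x\<in>?I. \<theta> x = b}) (h b))"
    by (rule tensor_integral_eq[OF lmeasurable_atLeastLessThan \<theta> _ img]) simp_all
  also have "\<dots> = tensor s t + tensor t (- s)"
  proof -
    have "measure lebesgue {a..<a + s} = s" "measure lebesgue {a + s..<a + s + t} = t"
      using assms by simp_all
    then show ?thesis
      using lev0 lev1 by (simp add: h_def)
  qed
  finally show ?thesis
    by (simp add: wedge_def tensor_minus_right)
qed

lemma wedge_add_left: "wedge (v + v') w = wedge v w + wedge v' w"
  and wedge_minus_left: "wedge (- v) w = - wedge v w"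
  and wedge_minus_right: "wedge v (- w) = - wedge v w"
  and wedge_scale_left: "wedge (of_rat c * v) w = tensor_scale c (wedge v w)"
  by (simp_all add: wedge_def tensor_add_left tensor_add_right tensor_minus_left tensor_minus_right
      tensor_scale_left tensor_scale_right tensor_space.scale_right_diff_distrib)

text \<open>
  An additive subgroup that contains the wedges of short vectors contains all wedges, since
  \<open>wedge (n u) (m z)\<close> is \<open>n m\<close> times \<open>wedge u z\<close>. It then contains their rational span, as a rational
  multiple of a wedge is again a wedge.
\<close>
lemma wedge_space_subset:
  assumes e: "0 < e" and zero: "0 \<in> H" and add: "\<And>x y. x \<in> H \<Longrightarrow> y \<in> H \<Longrightarrow> x + y \<in> H"
    and minus: "\<And>x. x \<in> H \<Longrightarrow> - x \<in> H"
    and small: "\<And>s t. 0 \<le> s \<Longrightarrow> s \<le> e \<Longrightarrow> 0 \<le> t \<Longrightarrow> t \<le> e \<Longrightarrow> wedge s t \<in> H"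
  shows "wedge_space \<subseteq> H"
proof -
  have mult_left: "wedge (real n * v) w \<in> H" if "wedge v w \<in> H" for n v w
  proof (induction n)
    case 0
    then show ?case
      using zero by (simp add: wedge_def)
  next
    case (Suc n)
    have "wedge (real (Suc n) * v) w = wedge v w + wedge (real n * v) w"
      by (simp only: wedge_add_left[symmetric]) (simp add: distrib_right)
    then show ?case
      using Suc that add by simp
  qed
  have swap: "wedge w v = - wedge v w" for v w
    by (simp add: wedge_def)
  have shrink: "\<exists>n u. v = real n * u \<and> 0 \<le> u \<and> u \<le> e" if "0 \<le> v" for v
  proof -
    obtain n where "v / e < real n"
      using reals_Archimedean2 by blast
    moreover have "0 \<le> v / e"
      using that e by simp
    ultimately have "0 < real n" "v \<le> real n * e"
      using e by (linarith, simp add: field_simps)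
    then show ?thesis
      using that by (intro exI[of _ n] exI[of _ "v / real n"]) (auto simp: field_simps)
  qed
  have nonneg: "wedge v w \<in> H" if vw: "0 \<le> v" "0 \<le> w" for v w
  proof -
    obtain n u m z where n: "v = real n * u" "0 \<le> u" "u \<le> e" and m: "w = real m * z" "0 \<le> z" "z \<le> e"
      using shrink vw by metis
    have "wedge (real n * u) z \<in> H"
      using mult_left small n m by blast
    then have "wedge (real m * z) (real n * u) \<in> H"
      using mult_left minus swap by metis
    then show ?thesis
      using minus swap n(1) m(1) by metis
  qed
  have wedge: "wedge v w \<in> H" for v w
    using nonneg[of "\<bar>v\<bar>" "\<bar>w\<bar>"] minus[of "wedge \<bar>v\<bar> \<bar>w\<bar>"]
    by (auto simp: abs_if wedge_minus_left wedge_minus_right split: if_splits)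
  show ?thesis
  proof
    fix X assume "X \<in> wedge_space"
    then show "X \<in> H"
      unfolding wedge_space_def
    proof (induction rule: tensor_space.span_induct_alt)
      case (step c x y)
      then show ?case
        using wedge add by (auto simp flip: wedge_scale_left)
    qed (rule zero)
  qed
qed

section \<open>The abelianization\<close>

text \<open>
  The pairing \<open>\<rho>\<close> is biadditive on the square of side \<open>L / 2\<close>, so it extends to a biadditive map \<open>B\<close>
  on all reals. The map of the tensor square induced by \<open>B\<close> itself would send \<open>wedge s t\<close> to
  \<open>\<rho> s t \<otimes> inv \<rho> t s\<close>, the square of \<open>\<rho> s t\<close>. The first argument is therefore halved, which is possible
  because the reals are divisible; no division in the target group is involved.
\<close>
lemma (in comm_group) wedge_universal:
  fixes \<rho> :: "real \<Rightarrow> real \<Rightarrow> 'a"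
  assumes L: "0 < L"
    and cl: "\<And>s t. 0 \<le> s \<Longrightarrow> 0 \<le> t \<Longrightarrow> s + t \<le> L \<Longrightarrow> \<rho> s t \<in> carrier G"
    and left: "\<And>s s' t. 0 \<le> s \<Longrightarrow> 0 \<le> s' \<Longrightarrow> 0 \<le> t \<Longrightarrow> s + s' + t \<le> L \<Longrightarrow>
      \<rho> (s + s') t = \<rho> s t \<otimes> \<rho> s' t"
    and right: "\<And>s t t'. 0 \<le> s \<Longrightarrow> 0 \<le> t \<Longrightarrow> 0 \<le> t' \<Longrightarrow> s + t + t' \<le> L \<Longrightarrow>
      \<rho> s (t + t') = \<rho> s t \<otimes> \<rho> s t'"
    and alt: "\<And>s t. 0 \<le> s \<Longrightarrow> 0 \<le> t \<Longrightarrow> s + t \<le> L \<Longrightarrow> \<rho> s t \<otimes> \<rho> t s = \<one>"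
  obtains \<Phi> :: "real_tensor \<Rightarrow> 'a"
  where "\<And>X. \<Phi> X \<in> carrier G" "\<And>X Y. \<Phi> (X + Y) = \<Phi> X \<otimes> \<Phi> Y"
    "\<And>s t. 0 \<le> s \<Longrightarrow> 0 \<le> t \<Longrightarrow> s + t \<le> L \<Longrightarrow> \<Phi> (wedge s t) = \<rho> s t"
proof -
  define e where "e = L / 2"
  have e: "0 < e"
    using L by (simp add: e_def)
  have \<rho>: "biadditive_on e \<rho>"
    unfolding biadditive_on_def additive_on_def using cl left right by (auto simp: e_def)
  define B where "B = biextend e \<rho>"
  have B_cl: "B v w \<in> carrier G" for v w
    unfolding B_def by (rule biextend_closed[OF e \<rho>])
  have B_left: "B (v + v') w = B v w \<otimes> B v' w" for v v' w
    unfolding B_def by (rule biextend_add_left[OF e \<rho>])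
  have B_right: "B v (w + w') = B v w \<otimes> B v w'" for v w w'
    unfolding B_def by (rule biextend_add_right[OF e \<rho>])
  have B_eq: "B s t = \<rho> s t" if "0 \<le> s" "s \<le> e" "0 \<le> t" "t \<le> e" for s t
    unfolding B_def by (rule biextend_eq[OF e \<rho> that])
  obtain \<Phi> where \<Phi>_cl: "\<And>X. \<Phi> X \<in> carrier G" and \<Phi>_add: "\<And>X Y. \<Phi> (X + Y) = \<Phi> X \<otimes> \<Phi> Y"
    and \<Phi>_tensor: "\<And>v w. \<Phi> (tensor v w) = B (v / 2) w"
  proof (rule tensor_universal[of "\<lambda>v w. B (v / 2) w"])
    fix \<Phi> :: "real_tensor \<Rightarrow> 'a"
    assume "\<And>X. \<Phi> X \<in> carrier G" "\<And>X Y. \<Phi> (X + Y) = \<Phi> X \<otimes> \<Phi> Y"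
      "\<And>v w. \<Phi> (tensor v w) = B (v / 2) w"
    then show thesis
      by (rule that)
  qed (simp_all add: B_cl B_left B_right add_divide_distrib)
  have \<Phi>_diff: "\<Phi> (X - Y) = \<Phi> X \<otimes> inv \<Phi> Y" for X Y
    using \<Phi>_add[of "X - Y" Y] \<Phi>_cl by (simp add: m_assoc)
  have "\<Phi> (wedge s t) = \<rho> s t" if st: "0 \<le> s" "0 \<le> t" "s + t \<le> L" for s t
  proof -
    \<comment> \<open>Both \<open>\<Phi> (wedge s t)\<close> and \<open>\<rho> s t\<close> are the fourth power of \<open>r\<close>. Halving both lengths also
       brings them down to at most \<open>L / 2\<close>, where \<open>B\<close> agrees with \<open>\<rho>\<close>.\<close>
    define r where "r = \<rho> (s / 2) (t / 2)"
    have half: "0 \<le> s / 2" "s / 2 \<le> e" "0 \<le> t / 2" "t / 2 \<le> e"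
      using st by (simp_all add: e_def)
    have r: "r \<in> carrier G"
      unfolding r_def using cl[of "s / 2" "t / 2"] st by simp
    have r': "inv (\<rho> (t / 2) (s / 2)) = r"
      unfolding r_def using cl[of "t / 2" "s / 2"] cl[of "s / 2" "t / 2"] alt[of "s / 2" "t / 2"] st
      by (intro inv_equality) simp_all
    have "B (s / 2) t = r \<otimes> r"
      using B_right[of "s / 2" "t / 2" "t / 2"] B_eq half by (simp add: r_def)
    moreover have "inv B (t / 2) s = r \<otimes> r"
      using B_right[of "t / 2" "s / 2" "s / 2"] B_eq half r' B_cl[of "t / 2" "s / 2"]
      by (simp add: inv_mult)
    ultimately have "\<Phi> (wedge s t) = (r \<otimes> r) \<otimes> (r \<otimes> r)"
      by (simp add: wedge_def \<Phi>_diff \<Phi>_tensor)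
    moreover have "\<rho> s t = \<rho> (s / 2) t \<otimes> \<rho> (s / 2) t"
      using left[of "s / 2" "s / 2" t] st by simp
    moreover have "\<rho> (s / 2) t = r \<otimes> r"
      using right[of "s / 2" "t / 2" "t / 2"] st by (simp add: r_def)
    ultimately show ?thesis
      by simp
  qed
  then show ?thesis
    using that \<Phi>_cl \<Phi>_add by blast
qed

lemma hom_eq_on_generated:
  assumes "group_hom G H \<phi>" "group_hom G H \<psi>" "S \<subseteq> carrier G"
    and "\<And>s. s \<in> S \<Longrightarrow> \<phi> s = \<psi> s" "x \<in> generate G S"
  shows "\<phi> x = \<psi> x"
proof -
  interpret \<phi>: group_hom G H \<phi> by fact
  interpret \<psi>: group_hom G H \<psi> by fact
  show ?thesis
    using assms(5)
  proof induction
    case (inv h)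
    then show ?case
      using assms(3,4) by (metis \<phi>.hom_inv \<psi>.hom_inv subsetD)
  next
    case (eng x y)
    then show ?case
      using \<phi>.G.generate_in_carrier[OF assms(3)] by simp
  qed (simp_all add: assms(4))
qed

lemma wedge_space_closed:
  "0 \<in> wedge_space" "wedge v w \<in> wedge_space"
  "X \<in> wedge_space \<Longrightarrow> Y \<in> wedge_space \<Longrightarrow> X + Y \<in> wedge_space"
  "X \<in> wedge_space \<Longrightarrow> - X \<in> wedge_space"
  unfolding wedge_space_def
  by (auto intro: tensor_space.span_zero tensor_space.span_base tensor_space.span_add
      tensor_space.span_neg)

lemma comm_group_wedge_group: "comm_group wedge_group"
  by (rule comm_groupI) (auto simp: wedge_group_def wedge_space_closed add_ac
      intro!: bexI[of _ "- _"])

locale interval_exchanges =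
  fixes p q :: real
  assumes p_less_q: "p < q"
begin

abbreviation "I \<equiv> {p..<q}"
abbreviation "G \<equiv> IET_group p q"
abbreviation "D \<equiv> derived G (carrier G)"
abbreviation "swap \<equiv> interval_swap p q"

lemma carrier_IET: "carrier G = {f. interval_exchange p q f}"
  by (simp add: IET_group_def)

lemma IET_mult:
  "f \<in> carrier G \<Longrightarrow> g \<in> carrier G \<Longrightarrow> f \<otimes>\<^bsub>G\<^esub> g = compose I f g"
  by (simp add: IET_group_def interval_exchange_def BijGroup_def)

lemma IET_one: "\<one>\<^bsub>G\<^esub> = (\<lambda>x\<in>I. x)"
  by (simp add: IET_group_def BijGroup_def)

lemma interval_swaps_Bij: "interval_swaps p q \<subseteq> carrier (BijGroup I)"
  by (auto simp: interval_swaps_def BijGroup_carrier interval_swap_Bij)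

lemma subgroup_IET: "subgroup {f. interval_exchange p q f} (BijGroup I)"
  unfolding interval_exchanges_eq_generate[OF p_less_q]
  by (rule group.generate_is_subgroup[OF group_BijGroup interval_swaps_Bij])

sublocale G: group G
  unfolding IET_group_def by (rule group.subgroup_imp_group[OF group_BijGroup subgroup_IET])

lemma swap_in_carrier:
  "p \<le> a \<Longrightarrow> 0 \<le> s \<Longrightarrow> 0 \<le> t \<Longrightarrow> a + s + t \<le> q \<Longrightarrow> swap a s t \<in> carrier G"
  by (simp add: carrier_IET interval_exchange_swap p_less_q)

lemma interval_swaps_carrier: "interval_swaps p q \<subseteq> carrier G"
  by (auto simp: interval_swaps_def swap_in_carrier)

lemma carrier_generated: "carrier G = generate G (interval_swaps p q)"
proof -
  have "generate G (interval_swaps p q) = generate (BijGroup I) (interval_swaps p q)"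
    using group.generate_consistent[OF group_BijGroup _ subgroup_IET] interval_swaps_carrier
    unfolding IET_group_def by (simp add: carrier_IET)
  then show ?thesis
    by (simp add: carrier_IET interval_exchanges_eq_generate p_less_q)
qed

sublocale A: comm_group "G Mod D"
  by (rule G.derived_quot_is_comm_group)

lemma hom_class: "(\<lambda>f. D #>\<^bsub>G\<^esub> f) \<in> hom G (G Mod D)"
  using normal.r_coset_hom_Mod[OF G.derived_self_is_normal] .

sublocale abel: group_hom G "G Mod D" "\<lambda>f. D #>\<^bsub>G\<^esub> f"
  by unfold_locales (rule hom_class)

text \<open>
  The class of a swap modulo the commutator group \<open>D\<close>, as a function of the two lengths; the position
  \<open>p\<close> is immaterial by \<open>class_swap\<close>.
\<close>
definition swap_class :: "real \<Rightarrow> real \<Rightarrow> (real \<Rightarrow> real) set" where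
  "swap_class s t = D #>\<^bsub>G\<^esub> swap p s t"

text \<open>
  Rotating the whole interval so that \<open>a\<close> moves to \<open>p\<close> conjugates the swap at \<open>a\<close> into the swap at
  \<open>p\<close>, and conjugate elements have the same class.
\<close>
lemma class_swap:
  assumes "p \<le> a" "0 \<le> s" "0 \<le> t" "a + s + t \<le> q"
  shows "D #>\<^bsub>G\<^esub> swap a s t = swap_class s t"
proof -
  define R where "R = swap p (a - p) (q - a)"
  have R: "R \<in> carrier G"
    unfolding R_def using assms by (intro swap_in_carrier) auto
  have sw: "swap a s t \<in> carrier G" "swap p s t \<in> carrier G"
    using assms by (auto intro!: swap_in_carrier)
  have "compose I R (swap a s t) = compose I (swap p s t) R"
    using assms by (auto simp: fun_eq_iff compose_def R_def interval_swap_def)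
  then have "R \<otimes>\<^bsub>G\<^esub> swap a s t = swap p s t \<otimes>\<^bsub>G\<^esub> R"
    using R sw by (simp add: IET_mult)
  then have "(D #>\<^bsub>G\<^esub> R) \<otimes>\<^bsub>G Mod D\<^esub> (D #>\<^bsub>G\<^esub> swap a s t) = (D #>\<^bsub>G\<^esub> swap p s t) \<otimes>\<^bsub>G Mod D\<^esub> (D #>\<^bsub>G\<^esub> R)"
    using R sw by (metis abel.hom_mult)
  also have "\<dots> = (D #>\<^bsub>G\<^esub> R) \<otimes>\<^bsub>G Mod D\<^esub> (D #>\<^bsub>G\<^esub> swap p s t)"
    using R sw abel.hom_closed A.m_comm by blast
  finally have eq: "(D #>\<^bsub>G\<^esub> R) \<otimes>\<^bsub>G Mod D\<^esub> (D #>\<^bsub>G\<^esub> swap a s t) =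
    (D #>\<^bsub>G\<^esub> R) \<otimes>\<^bsub>G Mod D\<^esub> (D #>\<^bsub>G\<^esub> swap p s t)" .
  have "D #>\<^bsub>G\<^esub> R \<in> Units (G Mod D)"
    unfolding A.Units_eq using R by (rule abel.hom_closed)
  from A.Units_l_cancel[OF this abel.hom_closed[OF sw(1)] abel.hom_closed[OF sw(2)]] eq
  show ?thesis
    unfolding swap_class_def by (rule iffD1)
qed

lemma swap_class_closed:
  "0 \<le> s \<Longrightarrow> 0 \<le> t \<Longrightarrow> s + t \<le> q - p \<Longrightarrow> swap_class s t \<in> carrier (G Mod D)"
  unfolding swap_class_def by (intro abel.hom_closed swap_in_carrier) auto

text \<open>
  Three adjacent intervals of lengths \<open>s\<close>, \<open>s'\<close>, \<open>t\<close>: the last one passes the first two one at a time.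
\<close>
lemma swap_class_add_left:
  assumes "0 \<le> s" "0 \<le> s'" "0 \<le> t" "s + s' + t \<le> q - p"
  shows "swap_class (s + s') t = swap_class s t \<otimes>\<^bsub>G Mod D\<^esub> swap_class s' t"
proof -
  have cl: "swap p s t \<in> carrier G" "swap (p + s) s' t \<in> carrier G"
    using assms by (auto intro!: swap_in_carrier)
  have "swap p (s + s') t = compose I (swap p s t) (swap (p + s) s' t)"
    using assms by (auto simp: fun_eq_iff compose_def interval_swap_def)
  then have "swap_class (s + s') t =
      (D #>\<^bsub>G\<^esub> swap p s t) \<otimes>\<^bsub>G Mod D\<^esub> (D #>\<^bsub>G\<^esub> swap (p + s) s' t)"
    unfolding swap_class_def using cl by (metis IET_mult abel.hom_mult)
  then show ?thesis
    using assms by (simp add: class_swap)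
qed

lemma swap_class_add_right:
  assumes "0 \<le> s" "0 \<le> t" "0 \<le> t'" "s + t + t' \<le> q - p"
  shows "swap_class s (t + t') = swap_class s t \<otimes>\<^bsub>G Mod D\<^esub> swap_class s t'"
proof -
  have cl: "swap p s t \<in> carrier G" "swap (p + t) s t' \<in> carrier G"
    using assms by (auto intro!: swap_in_carrier)
  have "swap p s (t + t') = compose I (swap (p + t) s t') (swap p s t)"
    using assms by (auto simp: fun_eq_iff compose_def interval_swap_def)
  then have "swap_class s (t + t') =
      (D #>\<^bsub>G\<^esub> swap (p + t) s t') \<otimes>\<^bsub>G Mod D\<^esub> (D #>\<^bsub>G\<^esub> swap p s t)"
    unfolding swap_class_def using cl by (metis IET_mult abel.hom_mult)
  then show ?thesis
    using assms A.m_comm[OF swap_class_closed[of s t'] swap_class_closed[of s t]]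
    by (simp add: class_swap)
qed

lemma swap_class_alternating:
  assumes "0 \<le> s" "0 \<le> t" "s + t \<le> q - p"
  shows "swap_class s t \<otimes>\<^bsub>G Mod D\<^esub> swap_class t s = \<one>\<^bsub>G Mod D\<^esub>"
proof -
  have cl: "swap p s t \<in> carrier G" "swap p t s \<in> carrier G"
    using assms by (auto intro!: swap_in_carrier)
  then have "swap p s t \<otimes>\<^bsub>G\<^esub> swap p t s = \<one>\<^bsub>G\<^esub>"
    using interval_swap_inverse[of p p t s q] assms by (simp add: IET_mult IET_one)
  then show ?thesis
    unfolding swap_class_def using cl by (metis abel.hom_mult abel.hom_one)
qed

lemma SAF_mult:
  "f \<in> carrier G \<Longrightarrow> g \<in> carrier G \<Longrightarrow>
    SAF_invariant p q (f \<otimes>\<^bsub>G\<^esub> g) = SAF_invariant p q f + SAF_invariant p q g"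
  by (simp add: IET_mult SAF_invariant_compose carrier_IET)

lemma SAF_one: "SAF_invariant p q \<one>\<^bsub>G\<^esub> = 0"
  using SAF_mult[of "\<one>\<^bsub>G\<^esub>" "\<one>\<^bsub>G\<^esub>"] by simp

lemma SAF_inv: "f \<in> carrier G \<Longrightarrow> SAF_invariant p q (inv\<^bsub>G\<^esub> f) = - SAF_invariant p q f"
  using SAF_mult[of "inv\<^bsub>G\<^esub> f" f] by (simp add: SAF_one eq_neg_iff_add_eq_0)

text \<open>
  It suffices to look at the generators, and there \<open>SAF_invariant_swap\<close> yields a single wedge.
\<close>
lemma SAF_in_wedge_space: "f \<in> carrier G \<Longrightarrow> SAF_invariant p q f \<in> wedge_space"
  unfolding carrier_generated
proof (induction rule: generate.induct)
  case (incl h)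
  then show ?case
    by (auto simp: interval_swaps_def SAF_invariant_swap wedge_space_closed)
next
  case (inv h)
  then have "h \<in> carrier G"
    using interval_swaps_carrier by blast
  then show ?case
    using inv by (auto simp: SAF_inv interval_swaps_def SAF_invariant_swap wedge_space_closed)
next
  case (eng f g)
  then show ?case
    by (simp add: SAF_mult carrier_generated wedge_space_closed)
qed (simp add: SAF_one wedge_space_closed)

lemma group_hom_SAF: "group_hom G wedge_group (SAF_invariant p q)"
proof -
  interpret W: comm_group wedge_group
    by (rule comm_group_wedge_group)
  show "group_hom G wedge_group (SAF_invariant p q)"
    by unfold_locales (auto intro!: homI simp: SAF_in_wedge_space SAF_mult wedge_group_def)
qed

lemma SAF_surjective: "SAF_invariant p q ` carrier G = carrier wedge_group"
proof
  show "SAF_invariant p q ` carrier G \<subseteq> carrier wedge_group"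
    using SAF_in_wedge_space by (auto simp: wedge_group_def)
  have "wedge_space \<subseteq> SAF_invariant p q ` carrier G"
  proof (rule wedge_space_subset[of "(q - p) / 2"])
    show "0 \<in> SAF_invariant p q ` carrier G"
      using SAF_one G.one_closed by (metis image_eqI)
    show "X + Y \<in> SAF_invariant p q ` carrier G"
      if "X \<in> SAF_invariant p q ` carrier G" "Y \<in> SAF_invariant p q ` carrier G" for X Y
      using that by (auto simp flip: SAF_mult)
    show "- X \<in> SAF_invariant p q ` carrier G" if "X \<in> SAF_invariant p q ` carrier G" for X
      using that by (auto simp flip: SAF_inv)
    show "wedge s t \<in> SAF_invariant p q ` carrier G"
      if "0 \<le> s" "s \<le> (q - p) / 2" "0 \<le> t" "t \<le> (q - p) / 2" for s t
    proof (rule image_eqI)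
      show "wedge s t = SAF_invariant p q (swap p s t)"
        using that by (simp add: SAF_invariant_swap)
    qed (use that in \<open>simp add: swap_in_carrier\<close>)
  qed (use p_less_q in simp)
  then show "carrier wedge_group \<subseteq> SAF_invariant p q ` carrier G"
    by (simp add: wedge_group_def)
qed

text \<open>
  The map \<open>\<Phi>\<close> of \<open>wedge_universal\<close> for the pairing \<open>swap_class\<close> turns the invariant of a swap into
  its class. Both sides are homomorphisms in \<open>f\<close>, so agreement on swaps is enough.
\<close>
lemma class_factors_through_SAF:
  "\<exists>\<Phi>. \<forall>f\<in>carrier G. D #>\<^bsub>G\<^esub> f = \<Phi> (SAF_invariant p q f)"
proof -
  obtain \<Phi> where \<Phi>: "\<And>X. \<Phi> X \<in> carrier (G Mod D)"
    "\<And>X Y. \<Phi> (X + Y) = \<Phi> X \<otimes>\<^bsub>G Mod D\<^esub> \<Phi> Y"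
    "\<And>s t. 0 \<le> s \<Longrightarrow> 0 \<le> t \<Longrightarrow> s + t \<le> q - p \<Longrightarrow> \<Phi> (wedge s t) = swap_class s t"
    by (rule A.wedge_universal[of "q - p" swap_class])
      (use p_less_q swap_class_closed swap_class_add_left swap_class_add_right
        swap_class_alternating in \<open>auto simp del: carrier_FactGroup\<close>)
  have hom: "group_hom G (G Mod D) (\<lambda>f. \<Phi> (SAF_invariant p q f))"
    by unfold_locales (auto intro!: homI simp: SAF_mult \<Phi>)
  have "D #>\<^bsub>G\<^esub> f = \<Phi> (SAF_invariant p q f)" if "f \<in> carrier G" for f
  proof (rule hom_eq_on_generated[OF abel.group_hom_axioms hom interval_swaps_carrier])
    show "D #>\<^bsub>G\<^esub> g = \<Phi> (SAF_invariant p q g)" if "g \<in> interval_swaps p q" for g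
      using that by (auto simp: interval_swaps_def class_swap SAF_invariant_swap \<Phi>(3))
  qed (use that carrier_generated in simp)
  then show ?thesis
    by blast
qed

text \<open>
  The invariant takes values in an abelian group, so it kills commutators. Conversely an exchange
  with zero invariant has the class \<open>\<Phi> 0\<close>, which is the class of the identity.
\<close>
lemma kernel_SAF: "kernel G wedge_group (SAF_invariant p q) = D"
proof
  obtain \<Phi> where \<Phi>: "\<And>f. f \<in> carrier G \<Longrightarrow> D #>\<^bsub>G\<^esub> f = \<Phi> (SAF_invariant p q f)"
    using class_factors_through_SAF by blast
  have D: "subgroup D G"
    by (simp add: G.derived_is_subgroup)
  show "kernel G wedge_group (SAF_invariant p q) \<subseteq> D"
  proof
    fix f assume "f \<in> kernel G wedge_group (SAF_invariant p q)"
    then have f: "f \<in> carrier G" "SAF_invariant p q f = 0"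
      by (auto simp: kernel_def wedge_group_def)
    have "D #>\<^bsub>G\<^esub> f = D #>\<^bsub>G\<^esub> \<one>\<^bsub>G\<^esub>"
      using \<Phi>[OF f(1)] \<Phi>[OF G.one_closed] f(2) SAF_one by (simp only:)
    then have "D #>\<^bsub>G\<^esub> f = D"
      using G.coset_mult_one subgroup.subset[OF D] by simp
    then show "f \<in> D"
      using G.rcos_self[OF f(1) D] by simp
  qed
  show "D \<subseteq> kernel G wedge_group (SAF_invariant p q)"
    unfolding derived_def
  proof (rule G.generate_subgroup_incl[OF _ group_hom.subgroup_kernel[OF group_hom_SAF]])
    show "derived_set G (carrier G) \<subseteq> kernel G wedge_group (SAF_invariant p q)"
      by (auto simp: kernel_def wedge_group_def SAF_mult SAF_inv)
  qed
qed

end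

theorem theorem1p2:
  fixes p q :: real
  assumes "p < q"
  shows "IET_group p q Mod derived (IET_group p q) (carrier (IET_group p q)) \<cong> wedge_group"
proof -
  interpret interval_exchanges p q
    by unfold_locales (rule assms)
  show ?thesis
    using group_hom.FactGroup_iso[OF group_hom_SAF SAF_surjective] by (simp add: kernel_SAF)
qed

end
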